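(* Let $p>2$ and let $n$ be the dimension. There are constants $\varepsilon_0=\varepsilon_0(p,n)>0$ and $C=C(p,n)$ such that if $0<\varepsilon<\varepsilon_0$ and $u_\varepsilon$ is a positive $p$-harmonious function (with step size $\varepsilon$) in $B_{10}(0)\subset\mathbb{R}^n$, normalized by $u_\varepsilon(0)=1$, then $$\sup_{B_1(0)}u_\varepsilon\le C.$$
   Context: $B_\rho(x)$ denotes the open ball of radius $\rho$ centered at $x$ in $\mathbb{R}^n$. Fix $p>2$ and set $\alpha=\frac{p-2}{n+p}$, $\beta=\frac{n+2}{n+p}$, so $\alpha+\beta=1$. For a bounded domain $\Omega\subset\mathbb{R}^n$ and $\varepsilon>0$ let $\Gamma_\varepsilon=\{x\in\mathbb{R}^n\setminus\Omega:\operatorname{dist}(x,\partial\Omega)\le\varepsilon\}$ and $\Omega_\varepsilon=\Omega\cup\Gamma_\varepsilon$. A $p$-harmonious function in $\Omega$ (with step size $\varepsilon$) is a bounded Borel measurable function $u_\varepsilon:\Omega_\varepsilon\to\mathbb{R}$ satisfying the dynamic programming principle $$u_\varepsilon(x)=\frac{\alpha}{2}\Big\{\inf_{B_\varepsilon(x)}u_\varepsilon+\sup_{B_\varepsilon(x)}u_\varepsilon\Big\}+\frac{\beta}{|B_\varepsilon(x)|}\int_{B_\varepsilon(x)}u_\varepsilon\,dy\qquad\text{for all }x\in\Omega.$$ (Equivalently, it is the value of the tug-of-war with noise game with payoff $F=u_\varepsilon|_{\Gamma_\varepsilon}$.) It is called positive if $u_\varepsilon>0$. *)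

theory Defs
  imports "HOL-Analysis.Analysis"
begin

definition tow_alpha :: "real \<Rightarrow> nat \<Rightarrow> real" where
  "tow_alpha p n = (p - 2) / (real n + p)"

definition tow_beta :: "real \<Rightarrow> nat \<Rightarrow> real" where
  "tow_beta p n = (real n + 2) / (real n + p)"

definition boundary_strip :: "real \<Rightarrow> (real ^ 'n) set \<Rightarrow> (real ^ 'n) set" where
  "boundary_strip \<epsilon> \<Omega> = {x. x \<notin> \<Omega> \<and> infdist x (frontier \<Omega>) \<le> \<epsilon>}"

definition extended_domain :: "real \<Rightarrow> (real ^ 'n) set \<Rightarrow> (real ^ 'n) set" where
  "extended_domain \<epsilon> \<Omega> = \<Omega> \<union> boundary_strip \<epsilon> \<Omega>"

(* Intended for a bounded domain \<Omega> and \<epsilon> > 0. A function on the extended domain is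
   represented by a total function; its values elsewhere are irrelevant, because
   ball x \<epsilon> lies in the extended domain for every x in \<Omega>. Boundedness makes the
   infimum and supremum genuine and, together with measurability, makes u integrable
   on each such ball. *)
definition p_harmonious ::
    "real \<Rightarrow> real \<Rightarrow> (real ^ 'n) set \<Rightarrow> (real ^ 'n \<Rightarrow> real) \<Rightarrow> bool" where
  "p_harmonious p \<epsilon> \<Omega> u \<longleftrightarrow>
     u \<in> borel_measurable (restrict_space borel (extended_domain \<epsilon> \<Omega>)) \<and>
     bounded (u ` extended_domain \<epsilon> \<Omega>) \<and>
     (\<forall>x\<in>\<Omega>. u x =
        tow_alpha p CARD('n) / 2 * ((INF y\<in>ball x \<epsilon>. u y) + (SUP y\<in>ball x \<epsilon>. u y)) +
        tow_beta p CARD('n) / measure lborel (ball x \<epsilon>) * (LINT y:ball x \<epsilon>|lborel. u y))"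

definition positive_p_harmonious ::
    "real \<Rightarrow> real \<Rightarrow> (real ^ 'n) set \<Rightarrow> (real ^ 'n \<Rightarrow> real) \<Rightarrow> bool" where
  "positive_p_harmonious p \<epsilon> \<Omega> u \<longleftrightarrow>
     p_harmonious p \<epsilon> \<Omega> u \<and> (\<forall>x\<in>extended_domain \<epsilon> \<Omega>. u x > 0)"

end

theory Submission
  imports Defs
begin

text \<open>
  Why the supremum is bounded. Three facts about a positive solution are combined.

  First (\<open>growth_from_ball\<close>), largeness spreads polynomially: if \<open>u \<ge> m\<close> on a ball of
  radius \<open>r\<close>, then \<open>u 0 \<ge> m (r / 8) ^ (2 j)\<close>. A function like \<open>norm y ^ (- 2 j)\<close> is a strict
  subsolution of the dynamic programming principle away from its pole once \<open>j\<close> is large, because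
  its radial second difference, seen by the tug term, is of order \<open>j\<^sup>2\<close>, while the averaging term
  loses only order \<open>j\<close>. It can therefore be slid below \<open>u\<close>.

  Secondly (\<open>oscillation_bound\<close>), \<open>u\<close> has a Hoelder-type modulus of continuity at all scales
  above \<open>\<epsilon>\<close>. The difference \<open>u x - u z\<close> is compared with an explicit function of the pair
  \<open>(x, z)\<close>, for a dynamic programming principle on pairs. The noise is coupled by translation, so
  that it leaves \<open>x - z\<close> unchanged. The gain comes from the tug of war alone: when one player moves
  the two points, the other either undoes the move or pulls the points together, and a concave
  function of their distance decreases on average. Both estimates rest on the weight \<open>\<alpha>\<close> of the tug
  term being positive, that is on \<open>p > 2\<close>.

  Thirdly (\<open>ball_le\<close>), one step of length \<open>\<epsilon>\<close> costs at most a factor \<open>\<alpha> / 2\<close>.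

  Suppose now that \<open>u 0 = 1\<close> and that \<open>u\<close> is very large at some point \<open>y\<close>, say
  \<open>u y > A / r ^ (2 j)\<close>. By the growth estimate \<open>u\<close> cannot stay above \<open>u y / 2\<close> on the ball of
  radius \<open>r\<close> about \<open>y\<close>, so \<open>u\<close> oscillates there by at least \<open>u y / 2\<close>; by the modulus of continuity
  it must exceed \<open>4 ^ j * A / r ^ (2 j)\<close> somewhere in a ball of radius comparable with \<open>r\<close>. This is
  the same hypothesis with \<open>r / 2\<close>, at a new point. These displacements form a geometric
  series, so that the points stay inside the domain, and the process runs until \<open>r\<close> reaches the
  step size. There the one-step bound gives a whole ball of radius \<open>2 \<epsilon>\<close> on which \<open>u\<close> is large,
  which contradicts the growth estimate when \<open>A\<close> is large (\<open>harnack_sup_bound\<close>).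
\<close>

section \<open>Averages over balls\<close>

text \<open>
  Averages are taken over the ball about the origin, in the displacement variable. Two points can
  then be moved by the same displacement, which is the coupling used later.
\<close>

definition ball_avg :: "real \<Rightarrow> ('a::euclidean_space \<Rightarrow> real) \<Rightarrow> real" where
  "ball_avg \<epsilon> f = (LINT h:ball 0 \<epsilon>|lborel. f h) / measure lborel (ball (0::'a) \<epsilon>)"

lemma ball_average_translation:
  fixes u :: "'a::euclidean_space \<Rightarrow> real"
  assumes meas: "(\<lambda>y. indicator (ball x \<epsilon>) y *\<^sub>R u y) \<in> borel_measurable borel"
    and "0 \<le> \<epsilon>"
  shows "(LINT y:ball x \<epsilon>|lborel. u y) / measure lborel (ball x \<epsilon>) = ball_avg \<epsilon> (\<lambda>h. u (x + h))"
proof -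
  have "(LINT y:ball x \<epsilon>|lborel. u y)
      = integral\<^sup>L (distr lborel borel ((+) x)) (\<lambda>y. indicator (ball x \<epsilon>) y *\<^sub>R u y)"
    by (simp add: set_lebesgue_integral_def lborel_distr_plus)
  also have "\<dots> = (LINT h|lborel. indicator (ball x \<epsilon>) (x + h) *\<^sub>R u (x + h))"
    by (rule integral_distr[OF _ meas]) simp
  also have "\<dots> = (LINT h:ball 0 \<epsilon>|lborel. u (x + h))"
    by (simp add: set_lebesgue_integral_def indicator_def dist_norm)
  finally have 1: "(LINT y:ball x \<epsilon>|lborel. u y) = (LINT h:ball 0 \<epsilon>|lborel. u (x + h))" .
  have "measure lborel (ball x \<epsilon>) = measure lborel (ball (0::'a) \<epsilon>)"
    using content_ball_conv_unit_ball[of \<epsilon> x] content_ball_conv_unit_ball[of \<epsilon> "0::'a"] assms(2) by simp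
  then show ?thesis using 1 by (simp add: ball_avg_def)
qed

lemma set_integrable_ball_continuous:
  fixes f :: "'a::euclidean_space \<Rightarrow> real"
  assumes "continuous_on UNIV f"
  shows "set_integrable lborel (ball c r) f"
proof -
  have "set_integrable lborel (cball c r) f"
    unfolding set_integrable_def
    by (rule borel_integrable_compact)
       (use assms continuous_on_subset in auto)
  then show ?thesis by (rule set_integrable_subset) auto
qed

text \<open>
  The ball is symmetric under reflection and the integrand is odd.
\<close>

lemma set_integral_inner_ball:
  fixes w :: "'a::euclidean_space"
  shows "(LINT h:ball 0 \<epsilon>|lborel. w \<bullet> h) = 0"
proof -
  have d: "distr lborel borel (uminus :: 'a \<Rightarrow> 'a) = lborel"
    using lborel_affine[of "-1" "0::'a"] by (simp add: density_1)
  have "(LINT h:ball 0 \<epsilon>|lborel. w \<bullet> h)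
      = integral\<^sup>L (distr lborel borel uminus) (\<lambda>h. indicator (ball 0 \<epsilon>) h *\<^sub>R (w \<bullet> h))"
    by (simp add: set_lebesgue_integral_def d)
  also have "\<dots> = (LINT h|lborel. indicator (ball 0 \<epsilon>) (-h) *\<^sub>R (w \<bullet> (-h)))"
    by (rule integral_distr)
       (auto intro!: borel_measurable_times borel_measurable_inner borel_measurable_indicator)
  also have "\<dots> = (LINT h|lborel. - (indicator (ball 0 \<epsilon>) h *\<^sub>R (w \<bullet> h)))"
    by (intro Bochner_Integration.integral_cong) (auto simp: indicator_def dist_norm)
  also have "\<dots> = - (LINT h:ball 0 \<epsilon>|lborel. w \<bullet> h)"
    by (simp add: set_lebesgue_integral_def)
  finally show ?thesis by simp
qed

text \<open>
  This is the only way in which averages are estimated: linear terms average out by symmetry, so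
  the noise never sees the first-order terms of a barrier.
\<close>

lemma ball_avg_le_affine:
  fixes f :: "'a::euclidean_space \<Rightarrow> real"
  assumes f: "set_integrable lborel (ball 0 \<epsilon>) f" and eps: "\<epsilon> > 0"
    and le: "\<And>h. norm h < \<epsilon> \<Longrightarrow> f h \<le> c + w \<bullet> h"
  shows "ball_avg \<epsilon> f \<le> c"
proof -
  have V: "measure lborel (ball (0::'a) \<epsilon>) > 0"
    using content_ball_pos[OF eps, of "0::'a"] by simp
  have "(LINT h:ball 0 \<epsilon>|lborel. f h) \<le> (LINT h:ball 0 \<epsilon>|lborel. c + w \<bullet> h)"
    by (rule set_integral_mono[OF f set_integrable_ball_continuous])
       (auto intro!: continuous_intros le)
  also have "\<dots> = (LINT h:ball (0::'a) \<epsilon>|lborel. c) + (LINT h:ball 0 \<epsilon>|lborel. w \<bullet> h)"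
    by (rule set_integral_add; rule set_integrable_ball_continuous) (auto intro!: continuous_intros)
  also have "\<dots> = c * measure lborel (ball (0::'a) \<epsilon>)"
    using emeasure_lborel_ball_finite[of "0::'a" \<epsilon>]
    by (simp add: set_integral_inner_ball) (simp add: set_lebesgue_integral_def)
  finally show ?thesis using V by (simp add: ball_avg_def divide_le_eq)
qed

lemma ball_avg_diff:
  assumes "set_integrable lborel (ball 0 \<epsilon>) f" "set_integrable lborel (ball 0 \<epsilon>) g"
  shows "ball_avg \<epsilon> (\<lambda>h. f h - g h) = ball_avg \<epsilon> f - ball_avg \<epsilon> g"
  using assms by (simp add: ball_avg_def diff_divide_distrib)

lemma ball_avg_ge_affine:
  fixes f :: "'a::euclidean_space \<Rightarrow> real"
  assumes f: "set_integrable lborel (ball 0 \<epsilon>) f" and eps: "\<epsilon> > 0"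
    and ge: "\<And>h. norm h < \<epsilon> \<Longrightarrow> f h \<ge> c + w \<bullet> h"
  shows "ball_avg \<epsilon> f \<ge> c"
proof -
  have "ball_avg \<epsilon> (\<lambda>h. - f h) \<le> - c"
    by (rule ball_avg_le_affine[where w = "- w"])
       (use f eps ge in \<open>fastforce simp: set_integrable_def\<close>)+
  then show ?thesis by (simp add: ball_avg_def set_lebesgue_integral_def)
qed

section \<open>Solutions of the dynamic programming principle\<close>

text \<open>
  The equation is required where a step cannot leave \<open>\<Omega>\<close>, so that it speaks of values on \<open>\<Omega>\<close>
  only; every argument below takes place at such points.
\<close>

locale tug_of_war_solution =
  fixes \<alpha> \<beta> \<epsilon> :: real and \<Omega> :: "'a::euclidean_space set" and u :: "'a \<Rightarrow> real"
  assumes alpha_pos: "\<alpha> > 0" and beta_pos: "\<beta> > 0" and alpha_beta: "\<alpha> + \<beta> = 1"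
    and eps_pos: "\<epsilon> > 0" and open_domain: "open \<Omega>"
    and meas: "u \<in> borel_measurable (restrict_space borel \<Omega>)"
    and bdd: "bounded (u ` \<Omega>)"
    and pos: "\<And>x. x \<in> \<Omega> \<Longrightarrow> u x > 0"
    and dpp: "\<And>x. ball x \<epsilon> \<subseteq> \<Omega> \<Longrightarrow>
       u x = \<alpha> / 2 * ((INF y\<in>ball x \<epsilon>. u y) + (SUP y\<in>ball x \<epsilon>. u y))
           + \<beta> / measure lborel (ball x \<epsilon>) * (LINT y:ball x \<epsilon>|lborel. u y)"
begin

lemma bdd_image: "S \<subseteq> \<Omega> \<Longrightarrow> bdd_above (u ` S) \<and> bdd_below (u ` S)"
  using bdd bounded_subset[of "u ` \<Omega>" "u ` S"]
  by (meson bounded_imp_bdd_above bounded_imp_bdd_below image_mono)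

lemma ball_measurable:
  assumes "ball x r \<subseteq> \<Omega>"
  shows "(\<lambda>y. indicator (ball x r) y *\<^sub>R u y) \<in> borel_measurable borel"
proof -
  have "u \<in> borel_measurable (restrict_space borel (ball x r))"
    using measurable_restrict_mono[OF meas assms] .
  then show ?thesis
    by (subst (asm) borel_measurable_restrict_space_iff) auto
qed

lemma integrable_shifted:
  assumes "ball x \<epsilon> \<subseteq> \<Omega>"
  shows "set_integrable lborel (ball 0 \<epsilon>) (\<lambda>h. u (x + h))"
proof -
  obtain B where B: "\<And>y. y \<in> \<Omega> \<Longrightarrow> \<bar>u y\<bar> \<le> B"
    using bdd by (auto simp: bounded_iff)
  have *: "(\<lambda>h. indicator (ball x \<epsilon>) (x + h) *\<^sub>R u (x + h)) \<in> borel_measurable borel"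
    using measurable_compose[OF _ ball_measurable[OF assms], of "(+) x" borel] by simp
  have eq: "indicator (ball x \<epsilon>) (x + h) = (indicator (ball 0 \<epsilon>) h :: real)" for h
    by (simp add: indicator_def dist_norm)
  show ?thesis
    unfolding set_integrable_def
  proof (rule Bochner_Integration.integrable_bound)
    show "integrable lborel (\<lambda>h. indicator (ball (0::'a) \<epsilon>) h *\<^sub>R B)"
      using set_integrable_ball_continuous[of "\<lambda>_. B" "0::'a" \<epsilon>]
      by (simp add: set_integrable_def)
    show "(\<lambda>h. indicator (ball 0 \<epsilon>) h *\<^sub>R u (x + h)) \<in> borel_measurable lborel"
      using * by (simp add: eq)
    have "\<bar>u (x + h)\<bar> \<le> \<bar>B\<bar>" if "norm h < \<epsilon>" for h
      using B[of "x + h"] assms that by (force simp: dist_norm)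
    then show "AE h in lborel. norm (indicator (ball 0 \<epsilon>) h *\<^sub>R u (x + h))
        \<le> norm (indicator (ball 0 \<epsilon>) h *\<^sub>R B)"
      by (auto simp: indicator_def)
  qed
qed

lemma dpp_avg:
  assumes "ball x \<epsilon> \<subseteq> \<Omega>"
  shows "u x = \<alpha> / 2 * ((INF y\<in>ball x \<epsilon>. u y) + (SUP y\<in>ball x \<epsilon>. u y))
           + \<beta> * ball_avg \<epsilon> (\<lambda>h. u (x + h))"
  using dpp[OF assms] ball_average_translation[OF ball_measurable[OF assms]] eps_pos
  by (metis less_imp_le times_divide_eq_left times_divide_eq_right)

text \<open>
  The step of the comparison argument for pairs. The suprema and infima at \<open>x\<close> and \<open>z\<close> are
  grouped as a maximising move \<open>sup\<^sub>x - inf\<^sub>z\<close> and a minimising one \<open>inf\<^sub>x - sup\<^sub>z\<close>. The latter is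
  kept inside the bound \<open>c\<^sub>2\<close>, so that the response may be chosen depending on the maximising move
  \<open>(x', z')\<close>.
\<close>

lemma one_step_upper:
  assumes x: "ball x \<epsilon> \<subseteq> \<Omega>" and z: "ball z \<epsilon> \<subseteq> \<Omega>"
    and le: "\<And>x' z'. x' \<in> ball x \<epsilon> \<Longrightarrow> z' \<in> ball z \<epsilon> \<Longrightarrow> u x' - u z' \<le> m + F x' z'"
    and noise: "\<And>h. norm h < \<epsilon> \<Longrightarrow> F (x + h) (z + h) \<le> c\<^sub>1 + w \<bullet> h"
    and tug: "\<And>x' z'. x' \<in> ball x \<epsilon> \<Longrightarrow> z' \<in> ball z \<epsilon> \<Longrightarrow>
        F x' z' + ((INF y\<in>ball x \<epsilon>. u y) - (SUP y\<in>ball z \<epsilon>. u y)) \<le> c\<^sub>2"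
  shows "u x - u z \<le> \<alpha> / 2 * (m + c\<^sub>2) + \<beta> * (m + c\<^sub>1)"
proof -
  define I J P Q where "I = (INF y\<in>ball x \<epsilon>. u y)" and "J = (INF y\<in>ball z \<epsilon>. u y)"
    and "P = (SUP y\<in>ball x \<epsilon>. u y)" and "Q = (SUP y\<in>ball z \<epsilon>. u y)"
  have ne: "ball x \<epsilon> \<noteq> {}" "ball z \<epsilon> \<noteq> {}" using eps_pos by auto
  have "P \<le> J + (m + c\<^sub>2 - (I - Q))" unfolding P_def
  proof (rule cSUP_least[OF ne(1)])
    fix x' assume x': "x' \<in> ball x \<epsilon>"
    have "u x' - (m + c\<^sub>2 - (I - Q)) \<le> J" unfolding J_def
    proof (rule cINF_greatest[OF ne(2)])
      fix z' assume "z' \<in> ball z \<epsilon>"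
      then show "u x' - (m + c\<^sub>2 - (I - Q)) \<le> u z'"
        using le[OF x'] tug[OF x', folded I_def Q_def] by fastforce
    qed
    then show "u x' \<le> J + (m + c\<^sub>2 - (I - Q))" by linarith
  qed
  then have "\<alpha> / 2 * ((I + P) - (J + Q)) \<le> \<alpha> / 2 * (m + c\<^sub>2)"
    using alpha_pos by (intro mult_left_mono) auto
  moreover have "ball_avg \<epsilon> (\<lambda>h. u (x + h) - u (z + h)) \<le> m + c\<^sub>1"
  proof (rule ball_avg_le_affine[OF _ eps_pos])
    show "set_integrable lborel (ball 0 \<epsilon>) (\<lambda>h. u (x + h) - u (z + h))"
      by (intro set_integral_diff integrable_shifted x z)
    show "u (x + h) - u (z + h) \<le> m + c\<^sub>1 + w \<bullet> h" if "norm h < \<epsilon>" for h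
      using le[of "x + h" "z + h"] noise[OF that] that by (simp add: dist_norm)
  qed
  then have "\<beta> * (ball_avg \<epsilon> (\<lambda>h. u (x + h)) - ball_avg \<epsilon> (\<lambda>h. u (z + h))) \<le> \<beta> * (m + c\<^sub>1)"
    using beta_pos by (simp add: ball_avg_diff[OF integrable_shifted[OF x] integrable_shifted[OF z]])
  moreover have "u x = \<alpha> / 2 * (I + P) + \<beta> * ball_avg \<epsilon> (\<lambda>h. u (x + h))"
    unfolding I_def P_def by (rule dpp_avg[OF x])
  moreover have "u z = \<alpha> / 2 * (J + Q) + \<beta> * ball_avg \<epsilon> (\<lambda>h. u (z + h))"
    unfolding J_def Q_def by (rule dpp_avg[OF z])
  ultimately show ?thesis by (simp add: right_diff_distrib)
qed

text \<open>
  The step of the comparison with a subsolution: \<open>a\<close>, \<open>b\<close> and \<open>c\<close> are the contributions of the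
  minimiser, of the maximiser and of the noise, and since \<open>\<alpha> + \<beta> = 1\<close> the common shift \<open>m\<close> comes out
  unchanged.
\<close>

lemma one_step_lower:
  assumes x: "ball x \<epsilon> \<subseteq> \<Omega>"
    and noise: "\<And>h. norm h < \<epsilon> \<Longrightarrow> m + c + w \<bullet> h \<le> u (x + h)"
    and inf: "\<And>y. y \<in> ball x \<epsilon> \<Longrightarrow> m + a \<le> u y"
    and sup: "m + b \<le> (SUP y\<in>ball x \<epsilon>. u y)"
  shows "m + (\<alpha> / 2 * (a + b) + \<beta> * c) \<le> u x"
proof -
  have "m + a \<le> (INF y\<in>ball x \<epsilon>. u y)"
    using eps_pos inf by (intro cINF_greatest) auto
  then have "\<alpha> / 2 * ((m + a) + (m + b)) \<le> \<alpha> / 2 * ((INF y\<in>ball x \<epsilon>. u y) + (SUP y\<in>ball x \<epsilon>. u y))"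
    using sup alpha_pos by (intro mult_left_mono) auto
  moreover have "\<beta> * (m + c) \<le> \<beta> * ball_avg \<epsilon> (\<lambda>h. u (x + h))"
    using beta_pos noise
    by (intro mult_left_mono ball_avg_ge_affine[OF integrable_shifted[OF x] eps_pos, of _ w]) auto
  moreover have "\<alpha> / 2 * ((m + a) + (m + b)) + \<beta> * (m + c)
      = (\<alpha> + \<beta>) * m + (\<alpha> / 2 * (a + b) + \<beta> * c)"
    by (simp add: field_simps)
  ultimately show ?thesis using dpp_avg[OF x] by (simp only: alpha_beta)
qed

end

section \<open>Elementary inequalities for small powers\<close>

lemma exp_le_quadratic:
  fixes x :: real
  assumes "\<bar>x\<bar> \<le> 1"
  shows "exp x \<le> 1 + x + x\<^sup>2"
proof (cases "0 \<le> x")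
  case True
  then show ?thesis using exp_bound[of x] assms by simp
next
  case False
  define v where "v = - x"
  have v: "0 < v" "v \<le> 1" using False assms by (auto simp: v_def)
  have "exp x * (1 + v) \<le> exp x * exp v"
    by (intro mult_left_mono exp_ge_add_one_self) auto
  also have "\<dots> = 1" by (simp add: v_def flip: exp_add)
  also have "1 \<le> 1 + v ^ 3" using v by simp
  also have "\<dots> = (1 - v + v\<^sup>2) * (1 + v)" by (simp add: algebra_simps power2_eq_square power3_eq_cube)
  finally have "exp x \<le> 1 - v + v\<^sup>2"
    using v by (simp add: mult_le_cancel_right)
  then show ?thesis by (simp add: v_def)
qed

text \<open>
  A displacement of length at most \<open>2 \<epsilon>\<close> changes \<open>t\<^sup>2 + \<epsilon>\<^sup>2\<close> by at most the order of
  \<open>\<epsilon> / sqrt (t\<^sup>2 + \<epsilon>\<^sup>2)\<close>, relatively. The summand \<open>\<epsilon>\<^sup>2\<close> regularises the power at \<open>t = 0\<close> and keeps the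
  ratio away from \<open>0\<close> when the displacement makes the two points meet.
\<close>

lemma ln_ratio_bound:
  fixes X t \<epsilon> :: real
  assumes eps: "\<epsilon> > 0" and t: "t \<ge> 2 * \<epsilon>"
    and X: "(t - 2*\<epsilon>)\<^sup>2 + \<epsilon>\<^sup>2 \<le> X" "X \<le> (t + 2*\<epsilon>)\<^sup>2 + \<epsilon>\<^sup>2"
  defines "q \<equiv> t\<^sup>2 + \<epsilon>\<^sup>2"
  shows "X > 0" "(ln (X / q))\<^sup>2 \<le> 1296 * (\<epsilon>\<^sup>2 / q)" "\<bar>ln (X / q)\<bar> \<le> 36"
proof -
  have q: "q > 0" using eps by (simp add: q_def add_nonneg_pos)
  \<comment> \<open>This is \<open>25\<close> times \<open>6 ((t - 2 \<epsilon>)\<^sup>2 + \<epsilon>\<^sup>2) - (t\<^sup>2 + \<epsilon>\<^sup>2)\<close> after completing the square.\<close>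
  have "5 * (5 * t - 12 * \<epsilon>)\<^sup>2 + 5 * \<epsilon>\<^sup>2 \<ge> 0" by simp
  then have "q \<le> 6 * ((t - 2*\<epsilon>)\<^sup>2 + \<epsilon>\<^sup>2)"
    unfolding q_def by (simp add: power2_eq_square algebra_simps)
  also have "6 * ((t - 2*\<epsilon>)\<^sup>2 + \<epsilon>\<^sup>2) \<le> 6 * X" using X(1) by (intro mult_left_mono) auto
  finally have X6: "q \<le> 6 * X" .
  then show X0: "X > 0" using q by linarith
  have tt: "4 * t * \<epsilon> + 4 * \<epsilon>\<^sup>2 \<le> 6 * t * \<epsilon>"
    using mult_right_mono[OF t, of \<epsilon>] eps by (simp add: power2_eq_square algebra_simps)
  have d: "\<bar>X - q\<bar> \<le> 6 * t * \<epsilon>"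
  proof (rule abs_leI)
    show "X - q \<le> 6 * t * \<epsilon>"
      using X(2) tt by (simp add: q_def power2_sum power_mult_distrib algebra_simps)
    have "0 \<le> t * \<epsilon>" using t eps by simp
    moreover have "(t - 2*\<epsilon>)\<^sup>2 + \<epsilon>\<^sup>2 = q - 4 * (t * \<epsilon>) + 4 * \<epsilon>\<^sup>2"
      by (simp add: q_def power2_eq_square algebra_simps)
    moreover have "6 * t * \<epsilon> = 6 * (t * \<epsilon>)" by simp
    ultimately show "- (X - q) \<le> 6 * t * \<epsilon>"
      using X(1) zero_le_power2[of \<epsilon>] by linarith
  qed
  have "\<bar>ln (X / q)\<bar> \<le> 6 * \<bar>X - q\<bar> / q"
  proof (cases "X \<ge> q")
    case True
    have "ln (X / q) \<le> X / q - 1" using q X0 by (intro ln_le_minus_one) simp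
    also have "\<dots> = (X - q) / q" using q by (simp add: diff_divide_distrib)
    also have "\<dots> \<le> 6 * (X - q) / q" using True q by (intro divide_right_mono) auto
    finally show ?thesis using True q X0 by (simp add: ln_ge_zero)
  next
    case False
    have "- ln (X / q) = ln (q / X)" using q X0 by (simp add: ln_div)
    also have "\<dots> \<le> q / X - 1" using q X0 by (intro ln_le_minus_one) simp
    also have "\<dots> = (q - X) / X" using X0 by (simp add: diff_divide_distrib)
    also have "\<dots> \<le> (q - X) / (q / 6)" using False X6 q by (intro divide_left_mono) auto
    finally have "- ln (X / q) \<le> 6 * (q - X) / q" by (simp add: mult.commute)
    moreover have "ln (X / q) \<le> 0" using False q X0 by simp
    ultimately show ?thesis using False by simp
  qed
  also have "\<dots> \<le> 6 * (6 * t * \<epsilon>) / q"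
    using d q by (intro divide_right_mono mult_left_mono) auto
  finally have l: "\<bar>ln (X / q)\<bar> \<le> 36 * (t * \<epsilon> / q)" by simp
  have "t * \<epsilon> \<le> t * t" using t eps by (intro mult_left_mono) auto
  then have "t * \<epsilon> \<le> q" by (simp add: q_def power2_eq_square add_increasing2)
  then have "t * \<epsilon> / q \<le> 1" using q by (simp add: divide_le_eq)
  with l show "\<bar>ln (X / q)\<bar> \<le> 36" by linarith
  have "(ln (X / q))\<^sup>2 \<le> (36 * (t * \<epsilon> / q))\<^sup>2"
    using l by (metis abs_ge_zero power2_abs power_mono)
  also have "\<dots> = 1296 * ((\<epsilon>\<^sup>2 / q) * (t\<^sup>2 / q))" by (simp add: power2_eq_square)
  also have "\<dots> \<le> 1296 * ((\<epsilon>\<^sup>2 / q) * 1)"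
    using q by (intro mult_left_mono) (auto simp: q_def divide_le_eq)
  finally show "(ln (X / q))\<^sup>2 \<le> 1296 * (\<epsilon>\<^sup>2 / q)" by simp
qed

text \<open>
  For a small exponent, \<open>(X / q) powr \<kappa>\<close> is close to \<open>1 + \<kappa> ln (X / q)\<close>. Hence a sum of powers is
  governed by the product \<open>X Y\<close>, which can be computed exactly in the geometric situations below.
  The quadratic remainder is at most \<open>2592 \<kappa>\<^sup>2 \<epsilon>\<^sup>2 / q\<close>; the bound on \<open>\<kappa>\<close> makes it smaller than half
  of the gain \<open>\<kappa> \<zeta>\<close>.
\<close>

lemma powr_sum_gain:
  fixes \<kappa> X Y t \<epsilon> \<zeta> :: real
  assumes k: "0 < \<kappa>" "\<kappa> \<le> 1 / 10000" and eps: "\<epsilon> > 0" and t: "t \<ge> 2 * \<epsilon>"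
    and X: "(t - 2*\<epsilon>)\<^sup>2 + \<epsilon>\<^sup>2 \<le> X" "X \<le> (t + 2*\<epsilon>)\<^sup>2 + \<epsilon>\<^sup>2"
    and Y: "(t - 2*\<epsilon>)\<^sup>2 + \<epsilon>\<^sup>2 \<le> Y" "Y \<le> (t + 2*\<epsilon>)\<^sup>2 + \<epsilon>\<^sup>2"
    and XY: "X * Y \<le> (t\<^sup>2 + \<epsilon>\<^sup>2)\<^sup>2 * (1 - \<zeta>)"
    and zeta: "\<zeta> \<ge> 4/5 * (\<epsilon>\<^sup>2 / (t\<^sup>2 + \<epsilon>\<^sup>2))"
  shows "X powr \<kappa> + Y powr \<kappa> \<le> (t\<^sup>2 + \<epsilon>\<^sup>2) powr \<kappa> * (2 - \<kappa> * \<zeta> / 2)"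
proof -
  define q where "q = t\<^sup>2 + \<epsilon>\<^sup>2"
  have q: "q > 0" using eps by (simp add: q_def add_nonneg_pos)
  define e where "e = \<epsilon>\<^sup>2 / q"
  note lx = ln_ratio_bound[OF eps t X, folded q_def e_def]
  note ly = ln_ratio_bound[OF eps t Y, folded q_def e_def]
  have one: "Z powr \<kappa> \<le> q powr \<kappa> * (1 + \<kappa> * ln (Z / q) + \<kappa>\<^sup>2 * (1296 * e))"
    if Z: "Z > 0" "(ln (Z / q))\<^sup>2 \<le> 1296 * e" "\<bar>ln (Z / q)\<bar> \<le> 36" for Z
  proof -
    have "\<bar>\<kappa> * ln (Z / q)\<bar> \<le> (1/10000) * 36"
      unfolding abs_mult using k Z by (intro mult_mono) auto
    then have "exp (\<kappa> * ln (Z / q)) \<le> 1 + \<kappa> * ln (Z / q) + (\<kappa> * ln (Z / q))\<^sup>2"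
      by (intro exp_le_quadratic) auto
    also have "\<dots> \<le> 1 + \<kappa> * ln (Z / q) + \<kappa>\<^sup>2 * (1296 * e)"
      using Z(2) by (simp add: power_mult_distrib mult_left_mono)
    finally have "(Z / q) powr \<kappa> \<le> 1 + \<kappa> * ln (Z / q) + \<kappa>\<^sup>2 * (1296 * e)"
      using Z q by (simp add: powr_def)
    then have "q powr \<kappa> * (Z / q) powr \<kappa> \<le> q powr \<kappa> * (1 + \<kappa> * ln (Z / q) + \<kappa>\<^sup>2 * (1296 * e))"
      by (intro mult_left_mono) auto
    then show ?thesis using Z q by (simp add: powr_divide)
  qed
  have "ln (X / q) + ln (Y / q) = ln (X * Y / q\<^sup>2)"
    using lx(1) ly(1) q by (simp add: ln_div ln_mult power2_eq_square)
  also have "\<dots> \<le> X * Y / q\<^sup>2 - 1" using lx(1) ly(1) q by (intro ln_le_minus_one) simp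
  also have "\<dots> \<le> - \<zeta>"
    using XY[folded q_def] q by (simp add: field_simps)
  finally have sum: "ln (X / q) + ln (Y / q) \<le> - \<zeta>" .
  have "\<kappa>\<^sup>2 * (2592 * e) \<le> \<kappa> * ((1/10000) * (2592 * e))"
  proof -
    have "0 \<le> 2592 * e" using q by (simp add: e_def)
    then have "\<kappa> * (\<kappa> * (2592 * e)) \<le> \<kappa> * ((1/10000) * (2592 * e))"
      using k by (intro mult_left_mono mult_right_mono) auto
    then show ?thesis by (simp add: power2_eq_square mult.assoc)
  qed
  also have "\<dots> \<le> \<kappa> * (\<zeta> / 2)"
  proof -
    have "0 \<le> e" using q by (simp add: e_def)
    moreover have "4/5 * e \<le> \<zeta>" using zeta by (simp add: e_def q_def)
    ultimately have "(1/10000) * (2592 * e) \<le> \<zeta> / 2" by linarith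
    then show ?thesis using k by (intro mult_left_mono) auto
  qed
  finally have sq: "\<kappa>\<^sup>2 * (2592 * e) \<le> \<kappa> * \<zeta> / 2" by simp
  have "X powr \<kappa> + Y powr \<kappa> \<le> q powr \<kappa> *
     ((1 + \<kappa> * ln (X / q) + \<kappa>\<^sup>2 * (1296 * e)) + (1 + \<kappa> * ln (Y / q) + \<kappa>\<^sup>2 * (1296 * e)))"
    using add_mono[OF one[OF lx] one[OF ly]] by (simp only: distrib_left)
  also have "\<dots> \<le> q powr \<kappa> * (2 - \<kappa> * \<zeta> / 2)"
  proof (rule mult_left_mono)
    have "\<kappa> * (ln (X / q) + ln (Y / q)) \<le> \<kappa> * (- \<zeta>)"
      using sum k by (intro mult_left_mono) auto
    then show "(1 + \<kappa> * ln (X / q) + \<kappa>\<^sup>2 * (1296 * e)) + (1 + \<kappa> * ln (Y / q) + \<kappa>\<^sup>2 * (1296 * e))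
        \<le> 2 - \<kappa> * \<zeta> / 2"
      using sq by (simp add: algebra_simps)
  qed simp
  finally show ?thesis by (simp add: q_def)
qed

text \<open>
  Both bounds compare exponents below \<open>1\<close>. They turn a gain relative to \<open>Q powr \<kappa>\<close> into an absolute
  one of second order or of first order in \<open>\<theta>\<close>.
\<close>

lemma powr_lower_bounds:
  fixes Q \<kappa> :: real
  assumes "0 < Q" "Q \<le> 2" "0 < \<kappa>" "\<kappa> \<le> 1/2"
  shows "Q / 2 \<le> Q powr \<kappa>" "sqrt Q / 2 \<le> Q powr \<kappa>"
proof -
  have *: "(Q / 2) powr \<kappa> \<le> Q powr \<kappa>" using assms by (intro powr_mono2) auto
  have "(Q / 2) powr 1 \<le> (Q / 2) powr \<kappa>" using assms by (intro powr_mono') auto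
  then show "Q / 2 \<le> Q powr \<kappa>" using * assms by simp
  have "(Q / 2) powr (1/2) \<le> (Q / 2) powr \<kappa>" using assms by (intro powr_mono') auto
  then have "sqrt (Q / 2) \<le> Q powr \<kappa>" using * assms by (simp add: powr_half_sqrt)
  moreover have "sqrt (Q / 2) \<ge> sqrt (Q / 4)" using assms by simp
  moreover have "sqrt (Q / 4) = sqrt Q / 2" by (simp add: real_sqrt_divide)
  ultimately show "sqrt Q / 2 \<le> Q powr \<kappa>" by simp
qed

section \<open>The tug of war on pairs of points\<close>

text \<open>
  The barrier for pairs, in coordinates scaled by the radius of the ball: \<open>s\<close> is the difference of
  the two points, \<open>w\<close> is their sum relative to the centre, and \<open>\<theta>\<close> is the step size. The first
  summand is the concave modulus of continuity, smoothed at the scale of one step; the second one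
  localises, since it reaches \<open>1\<close> when the midpoint of the pair is half a radius away from the centre.
\<close>

definition coupling_barrier :: "real \<Rightarrow> real \<Rightarrow> real \<Rightarrow> 'a::real_inner \<Rightarrow> 'a \<Rightarrow> real" where
  "coupling_barrier \<kappa> K \<theta> s w = K * ((norm s)\<^sup>2 + \<theta>\<^sup>2) powr \<kappa> + (norm w)\<^sup>2"

lemma norm_add_sq: "(norm (s + a))\<^sup>2 = (norm s)\<^sup>2 + 2 * (s \<bullet> a) + (norm a)\<^sup>2"
  for s a :: "'a::real_inner"
  by (simp add: power2_norm_eq_inner inner_add inner_commute)

lemma norm_add_sq_le:
  fixes w b :: "'a::real_inner"
  assumes "norm w < 1" "norm b \<le> 2 * \<theta>" "0 < \<theta>" "\<theta> \<le> 1"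
  shows "(norm (w + b))\<^sup>2 \<le> (norm w)\<^sup>2 + 8 * \<theta>"
proof -
  have "w \<bullet> b \<le> norm w * norm b" by (rule norm_cauchy_schwarz)
  also have "\<dots> \<le> 1 * (2 * \<theta>)" using assms by (intro mult_mono) auto
  finally have 1: "w \<bullet> b \<le> 2 * \<theta>" by simp
  have "(norm b)\<^sup>2 \<le> (2 * \<theta>)\<^sup>2" using assms by (intro power_mono) auto
  also have "\<dots> \<le> 4 * \<theta>" using assms by (simp add: power2_eq_square mult_left_le)
  finally show ?thesis using 1 by (simp add: norm_add_sq)
qed

text \<open>
  Here the two balls of possible moves overlap, so the minimising player can make the points meet
  and bring the difference of the values of \<open>u\<close> to \<open>0\<close>. It is therefore enough that no move doubles
  the barrier, and a small power of \<open>\<theta>\<^sup>2\<close> grows only by the factor \<open>17 powr \<kappa> \<le> 3/2\<close>.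
\<close>

lemma coupling_near:
  fixes s w h k :: "'a::real_inner"
  assumes \<kappa>: "0 < \<kappa>" "\<kappa> \<le> 1 / 10000" and \<theta>: "0 < \<theta>" "\<theta> \<le> 1"
    and w: "norm w < 1" and h: "norm h \<le> \<theta>" "norm k \<le> \<theta>"
    and \<Lambda>: "\<Lambda> \<ge> 0" and K: "K \<ge> 4000 * (8 + \<Lambda>)"
    and near: "norm s < 2 * \<theta>" and s: "norm s < 1"
  shows "coupling_barrier \<kappa> K \<theta> (s + (h - k)) (w + (h + k))
       \<le> 2 * coupling_barrier \<kappa> K \<theta> s w - \<Lambda> * \<theta>\<^sup>2"
proof -
  define Q where "Q = (norm s)\<^sup>2 + \<theta>\<^sup>2"
  have Q: "\<theta>\<^sup>2 \<le> Q" "0 < Q" using \<theta> by (auto simp: Q_def add_nonneg_pos)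
  have "Q \<le> 1\<^sup>2 + 1\<^sup>2" unfolding Q_def
    using s \<theta> by (intro add_mono power_mono) auto
  then have Q2: "Q \<le> 2" by simp
  have a: "norm (h - k) \<le> 2 * \<theta>" using norm_triangle_ineq4[of h k] h by simp
  have b: "norm (h + k) \<le> 2 * \<theta>" using norm_triangle_ineq[of h k] h by simp
  have "norm (s + (h - k)) \<le> 4 * \<theta>"
    using norm_triangle_ineq[of s "h - k"] a near by simp
  then have "(norm (s + (h - k)))\<^sup>2 \<le> (4 * \<theta>)\<^sup>2" by (intro power_mono) auto
  then have "((norm (s + (h - k)))\<^sup>2 + \<theta>\<^sup>2) powr \<kappa> \<le> (17 * \<theta>\<^sup>2) powr \<kappa>"
    using \<kappa> \<theta> by (intro powr_mono2) (auto simp: power_mult_distrib)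
  also have "\<dots> = 17 powr \<kappa> * (\<theta>\<^sup>2) powr \<kappa>" by (simp add: powr_mult)
  also have "\<dots> \<le> 3/2 * Q powr \<kappa>"
  proof (intro mult_mono powr_mono2)
    have l: "\<kappa> * ln 17 \<le> (1/10000) * 16"
      using \<kappa> ln_le_minus_one[of "17::real"] by (intro mult_mono) auto
    have "exp (\<kappa> * ln 17) \<le> exp (1/10)" using l by simp
    also have "\<dots> \<le> 3/2" using exp_le_quadratic[of "1/10"] by (simp add: power2_eq_square)
    finally show "17 powr \<kappa> \<le> 3/2" by (simp add: powr_def)
  qed (use \<kappa> \<theta> Q in auto)
  finally have X: "K * ((norm (s + (h - k)))\<^sup>2 + \<theta>\<^sup>2) powr \<kappa> \<le> 3/2 * (K * Q powr \<kappa>)"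
    using K \<Lambda> mult_left_mono[of "((norm (s + (h - k)))\<^sup>2 + \<theta>\<^sup>2) powr \<kappa>" "3/2 * Q powr \<kappa>" K]
    by (simp add: mult.left_commute)
  have W: "(norm (w + (h + k)))\<^sup>2 \<le> (norm w)\<^sup>2 + 8 * \<theta>"
    using norm_add_sq_le[OF w b \<theta>] .
  have "\<theta> \<le> sqrt Q" using Q \<theta> by (simp add: real_le_rsqrt)
  then have "\<theta> / 2 \<le> Q powr \<kappa>"
    using powr_lower_bounds(2)[OF Q(2) Q2, of \<kappa>] \<kappa> by simp
  then have "4 * (8 + \<Lambda>) * (\<theta> / 2) \<le> K * Q powr \<kappa>"
    using K \<Lambda> \<theta> by (intro mult_mono) auto
  then have G: "16 * \<theta> + 2 * (\<Lambda> * \<theta>) \<le> K * Q powr \<kappa>" by (simp add: algebra_simps)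
  have L: "0 \<le> \<Lambda> * \<theta>" using \<Lambda> \<theta> by simp
  have L2: "\<Lambda> * \<theta>\<^sup>2 \<le> \<Lambda> * \<theta>"
    using \<theta> \<Lambda> by (intro mult_left_mono) (auto simp: power2_eq_square mult_left_le)
  have arith: "A + N \<le> 2 * (B + M) - L2"
    if "16 * \<theta> + 2 * L1 \<le> B" "0 \<le> L1" "L2 \<le> L1" "0 \<le> M" "A \<le> 3/2 * B" "N \<le> M + 8 * \<theta>"
    for A N B M L1 L2 using that by simp
  show ?thesis
    using arith[OF G L L2 zero_le_power2 X W] unfolding coupling_barrier_def Q_def[symmetric] .
qed

text \<open>
  Every move \<open>(h, k)\<close> of the two points has a response that makes the barrier decrease on average.
  Write \<open>a = h - k\<close> for the change of the difference and \<open>b = h + k\<close> for the change of the sum.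

  If the points are many steps apart and \<open>a\<close> has a large component along \<open>s\<close>, the response is the
  reflected move. First-order terms cancel, the localising term costs only second order, and the
  radial concavity of the modulus wins over the transverse part of \<open>a\<close>, which is controlled by
  \<open>norm a \<le> 2 \<theta>\<close>.

  Otherwise the response moves the points straight towards each other. If they are many steps
  apart, the move has then wasted a fixed part of its possible radial component, so the modulus
  gains a term of first order in \<open>\<theta>\<close>. If they are only a few steps apart, second order and first
  order are the same up to constants. A first-order gain pays for the first-order cost \<open>8 \<theta>\<close> of the
  localising term. The thresholds \<open>20 \<theta>\<close> for the distance and \<open>8/5 \<theta>\<close> for the radial component are
  rational choices for which these cases fit together.
\<close>

lemma coupling_far:
  fixes s w h k :: "'a::real_inner"
  assumes \<kappa>: "0 < \<kappa>" "\<kappa> \<le> 1 / 10000" and \<theta>: "0 < \<theta>" "\<theta> \<le> 1"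
    and s: "norm s < 1" and w: "norm w < 1" and h: "norm h \<le> \<theta>" "norm k \<le> \<theta>"
    and \<Lambda>: "\<Lambda> \<ge> 0" and K: "K * \<kappa> \<ge> 4000 * (8 + \<Lambda>)"
    and far: "2 * \<theta> \<le> norm s"
  obtains h' k' where "norm h' \<le> \<theta>" "norm k' \<le> \<theta>"
    "coupling_barrier \<kappa> K \<theta> (s + (h - k)) (w + (h + k))
       + coupling_barrier \<kappa> K \<theta> (s + (h' - k')) (w + (h' + k'))
       \<le> 2 * coupling_barrier \<kappa> K \<theta> s w - \<Lambda> * \<theta>\<^sup>2"
proof -
  note respond = that
  define t where "t = norm s"
  define Q where "Q = t\<^sup>2 + \<theta>\<^sup>2"
  define a b where "a = h - k" and "b = h + k"
  have t: "0 < t" "2 * \<theta> \<le> t" "t < 1" using far \<theta> s by (auto simp: t_def)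
  have Q: "0 < Q" using \<theta> by (auto simp: Q_def add_nonneg_pos)
  have "Q \<le> 1\<^sup>2 + 1\<^sup>2" unfolding Q_def
    using t \<theta> by (intro add_mono power_mono) auto
  then have Q2: "Q \<le> 2" by simp
  have a: "norm a \<le> 2 * \<theta>" using norm_triangle_ineq4[of h k] h by (simp add: a_def)
  have b: "norm b \<le> 2 * \<theta>" using norm_triangle_ineq[of h k] h by (simp add: b_def)
  have Kpos: "0 \<le> K"
  proof -
    have "0 \<le> 4000 * (8 + \<Lambda>)" using \<Lambda> by simp
    then have "0 \<le> K * \<kappa>" using K by (rule order_trans)
    then show ?thesis using \<kappa> by (simp add: zero_le_mult_iff)
  qed
  have tt: "4 * \<theta>\<^sup>2 \<le> t\<^sup>2" using power_mono[OF t(2), of 2] \<theta> by (simp add: power_mult_distrib)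
  have step: "(t - 2 * \<theta>)\<^sup>2 \<le> (norm (s + c))\<^sup>2 \<and> (norm (s + c))\<^sup>2 \<le> (t + 2 * \<theta>)\<^sup>2"
    if "norm c \<le> 2 * \<theta>" for c
  proof -
    have "norm (s + c) \<le> t + 2 * \<theta>" "t - 2 * \<theta> \<le> norm (s + c)"
      using norm_triangle_ineq[of s c] norm_diff_ineq[of s c] that by (auto simp: t_def)
    then show ?thesis using t by (auto intro!: power_mono)
  qed
  \<comment> \<open>The relative gain of the product of two regularised squared distances in the cases of second order.\<close>
  define \<zeta>\<^sub>0 where "\<zeta>\<^sub>0 = t\<^sup>2 * \<theta>\<^sup>2 / Q\<^sup>2"
  have z0: "4/5 * (\<theta>\<^sup>2 / Q) \<le> \<zeta>\<^sub>0"
  proof -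
    have "4/5 \<le> t\<^sup>2 / Q" using tt Q by (simp add: le_divide_eq Q_def)
    then have "4/5 * (\<theta>\<^sup>2 / Q) \<le> t\<^sup>2 / Q * (\<theta>\<^sup>2 / Q)"
      using Q by (intro mult_right_mono) auto
    then show ?thesis by (simp add: \<zeta>\<^sub>0_def power2_eq_square)
  qed
  have z0Q: "Q\<^sup>2 * (1 - \<zeta>\<^sub>0) = Q\<^sup>2 - t\<^sup>2 * \<theta>\<^sup>2"
    using Q by (simp add: \<zeta>\<^sub>0_def right_diff_distrib)
  have P1: "Q / 2 \<le> Q powr \<kappa>" and P2: "sqrt Q / 2 \<le> Q powr \<kappa>"
    using powr_lower_bounds[OF Q Q2, of \<kappa>] \<kappa> by auto
  have gain: "K * (X powr \<kappa> + Y powr \<kappa>) \<le> 2 * (K * Q powr \<kappa>) - K * \<kappa> * (Q powr \<kappa> * \<zeta> / 2)"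
    if "(t - 2 * \<theta>)\<^sup>2 + \<theta>\<^sup>2 \<le> X" "X \<le> (t + 2 * \<theta>)\<^sup>2 + \<theta>\<^sup>2"
       "(t - 2 * \<theta>)\<^sup>2 + \<theta>\<^sup>2 \<le> Y" "Y \<le> (t + 2 * \<theta>)\<^sup>2 + \<theta>\<^sup>2"
       "X * Y \<le> Q\<^sup>2 * (1 - \<zeta>)" "4/5 * (\<theta>\<^sup>2 / Q) \<le> \<zeta>" for X Y \<zeta>
  proof -
    have "X powr \<kappa> + Y powr \<kappa> \<le> Q powr \<kappa> * (2 - \<kappa> * \<zeta> / 2)"
      using powr_sum_gain[OF \<kappa> \<theta>(1) t(2) that[unfolded Q_def]] by (simp add: Q_def)
    then have "K * (X powr \<kappa> + Y powr \<kappa>) \<le> K * (Q powr \<kappa> * (2 - \<kappa> * \<zeta> / 2))"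
      using Kpos by (intro mult_left_mono) auto
    then show ?thesis by (simp add: algebra_simps)
  qed
  have L: "\<Lambda> * \<theta>\<^sup>2 \<le> \<Lambda> * \<theta>"
    using \<theta> \<Lambda> by (intro mult_left_mono) (auto simp: power2_eq_square mult_left_le)
  have Kg: "(8 + \<Lambda>) * c \<le> K * \<kappa> * g" if "0 \<le> c" "c \<le> 4000 * g" for c g
  proof -
    have "(8 + \<Lambda>) * c \<le> (8 + \<Lambda>) * (4000 * g)" using that \<Lambda> by (intro mult_left_mono) auto
    also have "\<dots> = (4000 * (8 + \<Lambda>)) * g" by simp
    also have "\<dots> \<le> K * \<kappa> * g" using K that by (intro mult_right_mono) auto
    finally show ?thesis .
  qed
  show thesis
  proof (cases "20 * \<theta> \<le> t \<and> 8/5 * \<theta> * t \<le> s \<bullet> a")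
    case True
    define X Y where "X = (norm (s + a))\<^sup>2 + \<theta>\<^sup>2" and "Y = (norm (s + - a))\<^sup>2 + \<theta>\<^sup>2"
    have XY: "X * Y = (Q + (norm a)\<^sup>2)\<^sup>2 - 4 * (s \<bullet> a)\<^sup>2"
      unfolding X_def Y_def norm_add_sq Q_def t_def by (simp add: power2_eq_square algebra_simps)
    have "(norm a)\<^sup>2 \<le> (2 * \<theta>)\<^sup>2" using a by (intro power_mono) auto
    then have "(Q + (norm a)\<^sup>2)\<^sup>2 \<le> (Q + 4 * \<theta>\<^sup>2)\<^sup>2"
      using Q by (intro power_mono) (auto simp: power_mult_distrib)
    moreover have "(8/5 * \<theta> * t)\<^sup>2 \<le> (s \<bullet> a)\<^sup>2" using True t \<theta> by (intro power_mono) auto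
    moreover have "24 * (\<theta>\<^sup>2 * \<theta>\<^sup>2) \<le> t\<^sup>2 * \<theta>\<^sup>2"
    proof -
      have "(20 * \<theta>)\<^sup>2 \<le> t\<^sup>2" using True \<theta> by (intro power_mono) auto
      moreover have "(20 * \<theta>)\<^sup>2 = 400 * \<theta>\<^sup>2" by (simp add: power_mult_distrib)
      ultimately have "24 * \<theta>\<^sup>2 \<le> t\<^sup>2" using zero_le_power2[of \<theta>] by linarith
      then show ?thesis using mult_right_mono[of "24 * \<theta>\<^sup>2" "t\<^sup>2" "\<theta>\<^sup>2"] by (simp add: mult.assoc)
    qed
    moreover have "(8/5 * \<theta> * t)\<^sup>2 = 64/25 * (t\<^sup>2 * \<theta>\<^sup>2)"
      "(Q + 4 * \<theta>\<^sup>2)\<^sup>2 = Q\<^sup>2 + 8 * (t\<^sup>2 * \<theta>\<^sup>2) + 24 * (\<theta>\<^sup>2 * \<theta>\<^sup>2)"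
      by (simp_all add: Q_def power2_eq_square algebra_simps)
    moreover have "A - 4 * B \<le> C - D"
      if "A \<le> A'" "B' \<le> B" "24 * E \<le> D" "B' = 64/25 * D" "A' = C + 8 * D + 24 * E" "0 \<le> D"
      for A A' B B' C D E :: real using that by linarith
    moreover have "0 \<le> t\<^sup>2 * \<theta>\<^sup>2" by simp
    ultimately have XYle: "X * Y \<le> Q\<^sup>2 * (1 - \<zeta>\<^sub>0)"
      unfolding z0Q XY by blast
    have g: "K * (X powr \<kappa> + Y powr \<kappa>) \<le> 2 * (K * Q powr \<kappa>) - K * \<kappa> * (Q powr \<kappa> * \<zeta>\<^sub>0 / 2)"
      using step[of a] step[of "- a"] a
      by (intro gain XYle z0) (simp_all add: X_def Y_def)
    have "Q / 2 * (4/5 * (\<theta>\<^sup>2 / Q)) \<le> Q powr \<kappa> * \<zeta>\<^sub>0"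
      using Q P1 z0 by (intro mult_mono) auto
    moreover have "Q / 2 * (4/5 * (\<theta>\<^sup>2 / Q)) = 2/5 * \<theta>\<^sup>2" using Q by simp
    moreover have "0 \<le> \<theta>\<^sup>2" by simp
    ultimately have "\<theta>\<^sup>2 \<le> 4000 * (Q powr \<kappa> * \<zeta>\<^sub>0 / 2)" by linarith
    then have g2: "(8 + \<Lambda>) * \<theta>\<^sup>2 \<le> K * \<kappa> * (Q powr \<kappa> * \<zeta>\<^sub>0 / 2)" by (intro Kg) auto
    have "(norm b)\<^sup>2 \<le> (2 * \<theta>)\<^sup>2" using b by (intro power_mono) auto
    then have W: "(norm (w + b))\<^sup>2 + (norm (w + - b))\<^sup>2 \<le> 2 * (norm w)\<^sup>2 + 8 * \<theta>\<^sup>2"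
      unfolding norm_add_sq by (simp add: power_mult_distrib)
    have ab: "- h - - k = - a" "- h + - k = - b" by (auto simp: a_def b_def)
    have arith: "A + N + (B + N') \<le> 2 * (C + M) - \<Lambda> * \<theta>\<^sup>2"
      if "A + B \<le> 2 * C - G" "8 * \<theta>\<^sup>2 + \<Lambda> * \<theta>\<^sup>2 \<le> G" "N + N' \<le> 2 * M + 8 * \<theta>\<^sup>2"
      for A B C G N N' M using that by simp
    show thesis
    proof (rule respond[of "- h" "- k"])
      show "coupling_barrier \<kappa> K \<theta> (s + (h - k)) (w + (h + k))
       + coupling_barrier \<kappa> K \<theta> (s + (- h - - k)) (w + (- h + - k))
       \<le> 2 * coupling_barrier \<kappa> K \<theta> s w - \<Lambda> * \<theta>\<^sup>2"
        using arith[OF g[unfolded distrib_left] g2[unfolded distrib_right] W]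
        unfolding ab coupling_barrier_def a_def[symmetric] b_def[symmetric]
          X_def[symmetric] Y_def[symmetric] t_def[symmetric] Q_def[symmetric] .
    qed (use h in auto)
  next
    case False
    \<comment> \<open>The response is \<open>(- e, e)\<close>: it shortens the difference by \<open>2 \<theta>\<close> and fixes the sum.\<close>
    define e where "e = (\<theta> / t) *\<^sub>R s"
    have ne: "norm e = \<theta>" using t \<theta> by (simp add: e_def t_def)
    have "e + e = (2 * \<theta> / t) *\<^sub>R s"
      by (simp add: e_def flip: scaleR_left_distrib)
    then have "s + (- e - e) = (1 - 2 * \<theta> / t) *\<^sub>R s"
      unfolding scaleR_left_diff_distrib by (simp add: algebra_simps)
    then have "norm (s + (- e - e)) = \<bar>1 - 2 * \<theta> / t\<bar> * t" by (simp add: t_def)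
    also have "\<dots> = t - 2 * \<theta>" using t by (simp add: abs_if field_simps)
    finally have Y: "norm (s + (- e - e)) = t - 2 * \<theta>" .
    define Y where "Y = (t - 2 * \<theta>)\<^sup>2 + \<theta>\<^sup>2"
    have W: "(norm (w + b))\<^sup>2 \<le> (norm w)\<^sup>2 + 8 * \<theta>" using norm_add_sq_le[OF w b \<theta>] .
    have arith: "A' + N + (B + M) \<le> 2 * (C + M) - L2"
      if "A' \<le> A" "A + B \<le> 2 * C - G" "8 * \<theta> + L1 \<le> G" "N \<le> M + 8 * \<theta>" "L2 \<le> L1"
      for A A' B C G N M L1 L2 using that by simp
    have finish: thesis
      if X: "(norm (s + a))\<^sup>2 + \<theta>\<^sup>2 \<le> X"
        and g: "K * (X powr \<kappa> + Y powr \<kappa>) \<le> 2 * (K * Q powr \<kappa>) - K * \<kappa> * (Q powr \<kappa> * \<zeta> / 2)"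
        and g2: "\<theta> \<le> 4000 * (Q powr \<kappa> * \<zeta> / 2)" for X \<zeta>
    proof (rule respond[of "- e" e])
      have "K * ((norm (s + a))\<^sup>2 + \<theta>\<^sup>2) powr \<kappa> \<le> K * X powr \<kappa>"
        using X \<kappa> Kpos by (intro mult_left_mono powr_mono2) auto
      moreover have "(8 + \<Lambda>) * \<theta> \<le> K * \<kappa> * (Q powr \<kappa> * \<zeta> / 2)"
        using g2 \<theta> by (intro Kg) auto
      ultimately show "coupling_barrier \<kappa> K \<theta> (s + (h - k)) (w + (h + k))
       + coupling_barrier \<kappa> K \<theta> (s + (- e - e)) (w + (- e + e))
       \<le> 2 * coupling_barrier \<kappa> K \<theta> s w - \<Lambda> * \<theta>\<^sup>2"
        using arith[OF _ g[unfolded distrib_left] _ W L]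
        unfolding coupling_barrier_def a_def[symmetric] b_def[symmetric]
          Y Y_def[symmetric] t_def[symmetric] Q_def[symmetric] distrib_right by simp
    qed (use ne in auto)
    have t\<theta>: "0 \<le> t * \<theta>" using t \<theta> by simp
    have Yb: "(t - 2 * \<theta>)\<^sup>2 + \<theta>\<^sup>2 \<le> Y" "Y \<le> (t + 2 * \<theta>)\<^sup>2 + \<theta>\<^sup>2"
      using t\<theta> by (auto simp: Y_def power2_eq_square algebra_simps)
    show thesis
    proof (cases "t < 20 * \<theta>")
      case True
      define X where "X = (t + 2 * \<theta>)\<^sup>2 + \<theta>\<^sup>2"
      have "X * Y = Q\<^sup>2 - 8 * (t\<^sup>2 * \<theta>\<^sup>2) + 24 * (\<theta>\<^sup>2 * \<theta>\<^sup>2)"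
        unfolding X_def Y_def Q_def by (simp add: power2_eq_square algebra_simps)
      moreover have "4 * (\<theta>\<^sup>2 * \<theta>\<^sup>2) \<le> t\<^sup>2 * \<theta>\<^sup>2"
        using mult_right_mono[OF tt, of "\<theta>\<^sup>2"] by (simp add: mult.assoc)
      moreover have "0 \<le> t\<^sup>2 * \<theta>\<^sup>2" by simp
      ultimately have XY: "X * Y \<le> Q\<^sup>2 * (1 - \<zeta>\<^sub>0)" unfolding z0Q by linarith
      have "t\<^sup>2 \<le> (20 * \<theta>)\<^sup>2" using True t by (intro power_mono) auto
      then have "Q \<le> 401 * \<theta>\<^sup>2" by (simp add: Q_def power_mult_distrib)
      then have "1 / 401 \<le> \<theta>\<^sup>2 / Q" using Q by (simp add: field_simps)
      then have "1 / 600 \<le> \<zeta>\<^sub>0" using z0 by simp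
      moreover have "\<theta> \<le> sqrt Q" using \<theta> by (intro real_le_rsqrt) (simp add: Q_def)
      then have "\<theta> / 2 \<le> Q powr \<kappa>" using P2 by simp
      ultimately have "\<theta> / 2 * (1 / 600) \<le> Q powr \<kappa> * \<zeta>\<^sub>0"
        using \<theta> by (intro mult_mono) auto
      then show thesis
        using step[OF a] Yb t\<theta> XY z0 \<theta>
        by (intro finish[of X \<zeta>\<^sub>0] gain) (auto simp: X_def power2_eq_square algebra_simps)
    next
      case far: False
      \<comment> \<open>The squared distance after the move is at most \<open>X\<close>; together with \<open>Y\<close> the linear terms leave
        \<open>- 4/5 t \<theta> + 8 \<theta>\<^sup>2 \<le> - 2/5 t \<theta>\<close>, which explains \<open>\<zeta>\<close>.\<close>
      define X where "X = Q + 16/5 * \<theta> * t + 4 * \<theta>\<^sup>2"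
      define \<zeta> where "\<zeta> = 2/5 * (t * \<theta> / Q)"
      have sa: "s \<bullet> a < 8/5 * \<theta> * t" using False far by auto
      have "(norm a)\<^sup>2 \<le> (2 * \<theta>)\<^sup>2" using a by (intro power_mono) auto
      then have Xb: "(norm (s + a))\<^sup>2 + \<theta>\<^sup>2 \<le> X"
        using sa unfolding norm_add_sq X_def Q_def t_def by (simp add: power_mult_distrib)
      have \<theta>t: "20 * (\<theta> * \<theta>) \<le> t * \<theta>" using far \<theta> mult_right_mono[of "20 * \<theta>" t \<theta>] by simp
      have "X * Y = Q\<^sup>2 + Q * (8 * (\<theta> * \<theta>) - 4/5 * (t * \<theta>))
            - (16/5 * (t * \<theta>) + 4 * (\<theta> * \<theta>)) * (4 * (t * \<theta>) - 4 * (\<theta> * \<theta>))"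
        unfolding X_def Y_def Q_def by (simp add: power2_eq_square field_simps)
      also have "\<dots> \<le> Q\<^sup>2 + Q * (8 * (\<theta> * \<theta>) - 4/5 * (t * \<theta>))"
      proof -
        have "0 \<le> 16/5 * (t * \<theta>) + 4 * (\<theta> * \<theta>)" "0 \<le> 4 * (t * \<theta>) - 4 * (\<theta> * \<theta>)"
          using \<theta>t t\<theta> zero_le_square[of \<theta>] by linarith+
        then show ?thesis using mult_nonneg_nonneg by fastforce
      qed
      also have "\<dots> \<le> Q\<^sup>2 + Q * (- 2/5 * (t * \<theta>))"
        using Q \<theta>t by (intro add_left_mono mult_left_mono) auto
      also have "\<dots> = Q\<^sup>2 * (1 - \<zeta>)"
        using Q by (simp add: \<zeta>_def power2_eq_square algebra_simps)
      finally have XY: "X * Y \<le> Q\<^sup>2 * (1 - \<zeta>)" .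
      have z: "4/5 * (\<theta>\<^sup>2 / Q) \<le> \<zeta>"
      proof -
        have "2 * \<theta>\<^sup>2 \<le> t * \<theta>" unfolding power2_eq_square using \<theta>t zero_le_square[of \<theta>] by linarith
        then have "2 * \<theta>\<^sup>2 / Q \<le> t * \<theta> / Q" using Q by (intro divide_right_mono) auto
        then have "2/5 * (2 * \<theta>\<^sup>2 / Q) \<le> 2/5 * (t * \<theta> / Q)" by (intro mult_left_mono) auto
        then show ?thesis by (simp add: \<zeta>_def)
      qed
      have "1 / 2 \<le> t / sqrt Q"
      proof -
        have "\<theta>\<^sup>2 \<le> 3 * t\<^sup>2" using tt zero_le_power2[of \<theta>] by linarith
        then have "sqrt Q \<le> 2 * t" using t by (intro real_le_lsqrt) (auto simp: Q_def power_mult_distrib)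
        then show ?thesis using Q by (simp add: field_simps)
      qed
      then have "1/5 * \<theta> * (1/2) \<le> 1/5 * \<theta> * (t / sqrt Q)" using \<theta> by (intro mult_left_mono) auto
      also have "\<dots> = sqrt Q / 2 * \<zeta>" using Q by (simp add: \<zeta>_def field_simps)
      also have "\<dots> \<le> Q powr \<kappa> * \<zeta>"
        using P2 t\<theta> Q by (intro mult_right_mono) (auto simp: \<zeta>_def)
      finally have g2: "\<theta> \<le> 4000 * (Q powr \<kappa> * \<zeta> / 2)" using \<theta> by linarith
      have "X \<le> (t + 2 * \<theta>)\<^sup>2 + \<theta>\<^sup>2" "(t - 2 * \<theta>)\<^sup>2 + \<theta>\<^sup>2 \<le> X"
        using t\<theta> by (auto simp: X_def Q_def power2_eq_square algebra_simps)
      then show thesis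
        by (intro finish[of X \<zeta>] gain Xb XY z g2 Yb)
    qed
  qed
qed

section \<open>The modulus of continuity\<close>

context tug_of_war_solution
begin

text \<open>
  Let \<open>m\<close> be the supremum of \<open>u x - u z - F x z\<close> over all pairs in the ball, \<open>F\<close> being the scaled
  barrier. If \<open>m\<close> were positive, it would almost be attained at some pair. Such a pair lies where
  \<open>F < S\<close>, hence deep enough inside for the dynamic programming principle to hold at both points.
  There one step gives the value \<open>m\<close> minus a fixed positive amount, a contradiction. No continuity
  of \<open>u\<close> is involved, so an almost maximal pair has to suffice.

  The parameter \<open>\<Lambda>\<close> in the proof is the strength demanded of the tug gain: \<open>8 \<beta> / \<alpha>\<close> pays for the
  second-order effect of the noise on the localising term, and the additional \<open>2\<close> makes the
  comparison strict.
\<close>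

lemma oscillation_bound:
  assumes \<kappa>: "0 < \<kappa>" "\<kappa> \<le> 1 / 10000" and K: "K * \<kappa> \<ge> 4000 * (10 + 8 * \<beta> / \<alpha>)"
    and R: "\<epsilon> \<le> R" and dom: "ball x\<^sub>0 (R + \<epsilon>) \<subseteq> \<Omega>" and S: "0 < S"
    and uS: "\<And>y. y \<in> ball x\<^sub>0 (R + \<epsilon>) \<Longrightarrow> u y \<le> S"
    and x: "x \<in> ball x\<^sub>0 (R + \<epsilon>)" and z: "z \<in> ball x\<^sub>0 (R + \<epsilon>)"
  shows "u x - u z \<le> S * coupling_barrier \<kappa> K (\<epsilon> / R) ((x - z) /\<^sub>R R) ((x + z - 2 *\<^sub>R x\<^sub>0) /\<^sub>R R)"
proof (rule ccontr)
  define \<theta> where "\<theta> = \<epsilon> / R"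
  define \<Lambda> where "\<Lambda> = 8 * \<beta> / \<alpha> + 2"
  define s w where "s x z = (x - z) /\<^sub>R R" and "w x z = (x + z - 2 *\<^sub>R x\<^sub>0) /\<^sub>R R" for x z
  define F where "F x z = S * coupling_barrier \<kappa> K \<theta> (s x z) (w x z)" for x z
  have R0: "R > 0" using R eps_pos by linarith
  have \<theta>: "0 < \<theta>" "\<theta> \<le> 1" using R R0 eps_pos by (auto simp: \<theta>_def)
  have \<Lambda>: "\<Lambda> \<ge> 0" using alpha_pos beta_pos by (simp add: \<Lambda>_def)
  have K\<Lambda>: "K * \<kappa> \<ge> 4000 * (8 + \<Lambda>)" using K by (simp add: \<Lambda>_def)
  have Kbig: "K \<ge> 4000 * (8 + \<Lambda>)"
  proof -
    have "0 \<le> K"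
    proof (rule ccontr)
      assume "\<not> 0 \<le> K"
      then have "K * \<kappa> \<le> 0" using \<kappa> by (simp add: mult_nonpos_nonneg)
      then show False using K\<Lambda> \<Lambda> by simp
    qed
    then have "K * \<kappa> \<le> K * 1" using \<kappa> by (intro mult_left_mono) auto
    then show ?thesis using K\<Lambda> by linarith
  qed
  have K1: "1 \<le> K" using Kbig \<Lambda> by simp
  have F0: "0 \<le> F x z" for x z using S K1 by (simp add: F_def coupling_barrier_def)
  define E where "E = ball x\<^sub>0 (R + \<epsilon>)"
  define G where "G p = u (fst p) - u (snd p) - F (fst p) (snd p)" for p
  have GS: "G p \<le> S" if "p \<in> E \<times> E" for p
  proof -
    have "u (fst p) \<le> S" "0 < u (snd p)" using that uS pos dom by (auto simp: E_def)
    then show ?thesis using F0[of "fst p" "snd p"] by (simp add: G_def)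
  qed
  have bddG: "bdd_above (G ` (E \<times> E))" using GS by (intro bdd_aboveI2[where M = S])
  define m where "m = Sup (G ` (E \<times> E))"
  have upper: "u x - u z \<le> m + F x z" if "x \<in> E" "z \<in> E" for x z
  proof -
    have "G (x, z) \<le> m" unfolding m_def by (rule cSUP_upper[OF _ bddG]) (use that in simp)
    then show ?thesis by (simp add: G_def)
  qed
  assume "\<not> u x - u z \<le> S * coupling_barrier \<kappa> K (\<epsilon> / R) ((x - z) /\<^sub>R R) ((x + z - 2 *\<^sub>R x\<^sub>0) /\<^sub>R R)"
  then have "0 < u x - u z - F x z" by (simp add: F_def s_def w_def \<theta>_def)
  then have m0: "0 < m" using upper[of x z] x z by (simp add: E_def)
  have \<delta>: "0 < \<alpha> * S * \<theta>\<^sup>2" using alpha_pos S \<theta> by simp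
  have "max 0 (m - \<alpha> * S * \<theta>\<^sup>2) < Sup (G ` (E \<times> E))"
    using m0 \<delta> by (simp add: m_def)
  moreover have "(x, z) \<in> E \<times> E" using x z by (simp add: E_def)
  ultimately obtain p where p: "p \<in> E \<times> E" "max 0 (m - \<alpha> * S * \<theta>\<^sup>2) < G p"
    by (subst (asm) less_cSup_iff) (use bddG in auto)
  obtain a b where ab: "p = (a, b)" by fastforce
  have abE: "a \<in> E" "b \<in> E" and G0: "F a b < u a - u b"
    and Gm: "m - \<alpha> * S * \<theta>\<^sup>2 < u a - u b - F a b"
    using p by (auto simp: ab G_def)
  have "u a \<le> S" "0 < u b" using abE uS pos dom by (auto simp: E_def)
  then have "F a b < S * 1" using G0 by simp
  then have c1: "coupling_barrier \<kappa> K \<theta> (s a b) (w a b) < 1"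
    unfolding F_def using S by (simp only: mult_less_cancel_left_pos)
  have s1: "norm (s a b) < 1"
  proof (rule ccontr)
    assume "\<not> norm (s a b) < 1"
    then have "1 \<le> (norm (s a b))\<^sup>2" by (simp add: one_le_power)
    then have "1 \<le> (norm (s a b))\<^sup>2 + \<theta>\<^sup>2" by (simp add: add_increasing2)
    then have "1 \<le> ((norm (s a b))\<^sup>2 + \<theta>\<^sup>2) powr \<kappa>" using \<kappa> by (simp add: ge_one_powr_ge_zero)
    then have "1 * 1 \<le> K * ((norm (s a b))\<^sup>2 + \<theta>\<^sup>2) powr \<kappa>"
      using K1 by (intro mult_mono) auto
    then show False using c1 zero_le_power2[of "norm (w a b)"] unfolding coupling_barrier_def by linarith
  qed
  have w1: "norm (w a b) < 1"
  proof (rule ccontr)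
    assume "\<not> norm (w a b) < 1"
    then have "1 \<le> (norm (w a b))\<^sup>2" by (simp add: one_le_power)
    moreover have "0 \<le> K * ((norm (s a b))\<^sup>2 + \<theta>\<^sup>2) powr \<kappa>" using K1 by simp
    ultimately show False using c1 unfolding coupling_barrier_def by linarith
  qed
  have "a - x\<^sub>0 = (R / 2) *\<^sub>R (w a b + s a b)" "b - x\<^sub>0 = (R / 2) *\<^sub>R (w a b - s a b)"
    using R0 by (simp_all add: w_def s_def algebra_simps flip: scaleR_add_left)
  moreover have "norm (w a b + s a b) < 2" "norm (w a b - s a b) < 2"
    using norm_triangle_ineq[of "w a b" "s a b"] norm_triangle_ineq4[of "w a b" "s a b"] s1 w1 by auto
  ultimately have "dist x\<^sub>0 a < R" "dist x\<^sub>0 b < R"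
    using R0 by (simp_all add: dist_norm norm_minus_commute[of x\<^sub>0])
  then have aE: "ball a \<epsilon> \<subseteq> E" and bE: "ball b \<epsilon> \<subseteq> E"
    unfolding E_def by (auto simp: ball_subset_ball_iff dist_commute)
  have shift: "s (a + h) (b + k) = s a b + (h /\<^sub>R R - k /\<^sub>R R)"
    "w (a + h) (b + k) = w a b + (h /\<^sub>R R + k /\<^sub>R R)" for h k
    by (simp_all add: s_def w_def algebra_simps)
  have scaled: "norm (h /\<^sub>R R) \<le> \<theta>" if "norm h \<le> \<epsilon>" for h :: 'a
    using that R0 by (simp add: \<theta>_def divide_inverse mult.commute mult_left_mono)
  have "u a - u b \<le> \<alpha> / 2 * (m + (m + 2 * F a b - S * (\<Lambda> * \<theta>\<^sup>2))) + \<beta> * (m + (F a b + 4 * S * \<theta>\<^sup>2))"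
  proof (rule one_step_upper[where F = F and w = "(4 * S / R) *\<^sub>R w a b"])
    show "ball a \<epsilon> \<subseteq> \<Omega>" "ball b \<epsilon> \<subseteq> \<Omega>" using aE bE dom by (auto simp: E_def)
    show "u x' - u z' \<le> m + F x' z'" if "x' \<in> ball a \<epsilon>" "z' \<in> ball b \<epsilon>" for x' z'
      using upper that aE bE by blast
    show "F (a + h) (b + h) \<le> F a b + 4 * S * \<theta>\<^sup>2 + (4 * S / R) *\<^sub>R w a b \<bullet> h" if "norm h < \<epsilon>" for h
    proof -
      have "(norm (v + v))\<^sup>2 = 4 * (norm v)\<^sup>2" for v :: 'a
        by (simp add: power2_norm_eq_inner inner_add_left inner_add_right)
      then have "(norm (h /\<^sub>R R + h /\<^sub>R R))\<^sup>2 = 4 * (norm (h /\<^sub>R R))\<^sup>2" .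
      also have "\<dots> \<le> 4 * \<theta>\<^sup>2" using scaled[of h] that by (intro mult_left_mono power_mono) auto
      finally have "(norm (w a b + (h /\<^sub>R R + h /\<^sub>R R)))\<^sup>2
          \<le> (norm (w a b))\<^sup>2 + (4 / R) * (w a b \<bullet> h) + 4 * \<theta>\<^sup>2"
        by (simp add: norm_add_sq inner_add_right divide_inverse mult.commute)
      then have "coupling_barrier \<kappa> K \<theta> (s (a + h) (b + h)) (w (a + h) (b + h))
          \<le> coupling_barrier \<kappa> K \<theta> (s a b) (w a b) + ((4 / R) * (w a b \<bullet> h) + 4 * \<theta>\<^sup>2)"
        by (simp add: shift coupling_barrier_def)
      then have "F (a + h) (b + h) \<le> S * (coupling_barrier \<kappa> K \<theta> (s a b) (w a b) + ((4 / R) * (w a b \<bullet> h) + 4 * \<theta>\<^sup>2))"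
        unfolding F_def using S by (intro mult_left_mono) auto
      then show ?thesis by (simp add: F_def algebra_simps)
    qed
  next
    define I where "I = (INF y\<in>ball a \<epsilon>. u y) - (SUP y\<in>ball b \<epsilon>. u y)"
    have I_le: "I \<le> u x' - u z'" if "x' \<in> ball a \<epsilon>" "z' \<in> ball b \<epsilon>" for x' z'
    proof -
      have "(INF y\<in>ball a \<epsilon>. u y) \<le> u x'"
        by (rule cINF_lower[OF _ that(1)]) (use bdd_image[of "ball a \<epsilon>"] aE dom in \<open>auto simp: E_def\<close>)
      moreover have "u z' \<le> (SUP y\<in>ball b \<epsilon>. u y)"
        by (rule cSUP_upper[OF that(2)]) (use bdd_image[of "ball b \<epsilon>"] bE dom in \<open>auto simp: E_def\<close>)
      ultimately show ?thesis by (simp add: I_def)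
    qed
    \<comment> \<open>Steps of length exactly \<open>\<epsilon>\<close> are not admissible in the open ball, but \<open>F\<close> is continuous, so they
      may be used as responses after passing to the limit.\<close>
    have I_closed: "I \<le> m + F (a + h) (b + k)" if h: "norm h \<le> \<epsilon>" "norm k \<le> \<epsilon>" for h k
    proof (rule tendsto_lowerbound)
      have nz: "(norm v)\<^sup>2 + \<theta>\<^sup>2 \<noteq> 0" for v :: 'a using \<theta> by (simp add: add_nonneg_eq_0_iff)
      have "isCont (\<lambda>c. m + F (a + c *\<^sub>R h) (b + c *\<^sub>R k)) 1"
        unfolding F_def s_def w_def coupling_barrier_def
        by (intro continuous_intros) (use \<theta> in \<open>simp add: nz\<close>)
      then show "((\<lambda>c. m + F (a + c *\<^sub>R h) (b + c *\<^sub>R k)) \<longlongrightarrow> m + F (a + h) (b + k)) (at_left 1)"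
        by (simp add: isCont_def filterlim_at_split)
      have "I \<le> m + F (a + c *\<^sub>R h) (b + c *\<^sub>R k)" if c: "0 < c" "c < 1" for c
      proof -
        have "norm (c *\<^sub>R v) < \<epsilon>" if "norm v \<le> \<epsilon>" for v :: 'a
        proof -
          have "c * norm v \<le> c * \<epsilon>" using that c by (intro mult_left_mono) auto
          also have "\<dots> < 1 * \<epsilon>" using c eps_pos by (intro mult_strict_right_mono) auto
          finally show ?thesis using c by simp
        qed
        then have "a + c *\<^sub>R h \<in> ball a \<epsilon>" "b + c *\<^sub>R k \<in> ball b \<epsilon>" using h by (auto simp: dist_norm)
        then show ?thesis using I_le upper aE bE by (meson order_trans subsetD)
      qed
      then show "\<forall>\<^sub>F c in at_left 1. I \<le> m + F (a + c *\<^sub>R h) (b + c *\<^sub>R k)"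
        by (intro eventually_at_leftI[of 0]) auto
    qed simp
    show "F x' z' + ((INF y\<in>ball a \<epsilon>. u y) - (SUP y\<in>ball b \<epsilon>. u y)) \<le> m + 2 * F a b - S * (\<Lambda> * \<theta>\<^sup>2)"
      if xz: "x' \<in> ball a \<epsilon>" "z' \<in> ball b \<epsilon>" for x' z'
    proof -
      define h k where "h = (x' - a) /\<^sub>R R" and "k = (z' - b) /\<^sub>R R"
      have hk: "norm h \<le> \<theta>" "norm k \<le> \<theta>"
        unfolding h_def k_def by (rule scaled; use xz in \<open>simp add: dist_norm norm_minus_commute\<close>)+
      have F': "F x' z' = S * coupling_barrier \<kappa> K \<theta> (s a b + (h - k)) (w a b + (h + k))"
        using shift[of "x' - a" "z' - b"] by (simp add: F_def h_def k_def)
      show ?thesis unfolding I_def[symmetric]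
      proof (cases "norm (s a b) < 2 * \<theta>")
        case True
        have "norm (s a b) = norm (a - b) / R" using R0 by (simp add: s_def divide_inverse mult.commute)
        then have "dist a b < 2 * \<epsilon>" using True R0 by (simp add: \<theta>_def dist_norm field_simps)
        then have "midpoint a b \<in> ball a \<epsilon>" "midpoint a b \<in> ball b \<epsilon>"
          by (simp_all add: dist_midpoint)
        then have "I \<le> 0" using I_le by fastforce
        moreover have "F x' z' \<le> S * (2 * coupling_barrier \<kappa> K \<theta> (s a b) (w a b) - \<Lambda> * \<theta>\<^sup>2)"
          unfolding F' using S coupling_near[OF \<kappa> \<theta> w1 hk \<Lambda> Kbig True s1]
          by (intro mult_left_mono) auto
        ultimately show "F x' z' + I \<le> m + 2 * F a b - S * (\<Lambda> * \<theta>\<^sup>2)"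
          using m0 by (simp add: F_def algebra_simps)
      next
        case False
        then have far: "2 * \<theta> \<le> norm (s a b)" by simp
        obtain h' k' where hk': "norm h' \<le> \<theta>" "norm k' \<le> \<theta>"
          and le: "coupling_barrier \<kappa> K \<theta> (s a b + (h - k)) (w a b + (h + k))
             + coupling_barrier \<kappa> K \<theta> (s a b + (h' - k')) (w a b + (h' + k'))
             \<le> 2 * coupling_barrier \<kappa> K \<theta> (s a b) (w a b) - \<Lambda> * \<theta>\<^sup>2"
          using coupling_far[OF \<kappa> \<theta> s1 w1 hk \<Lambda> K\<Lambda> far] by blast
        have "norm (R *\<^sub>R h') \<le> \<epsilon>" "norm (R *\<^sub>R k') \<le> \<epsilon>"
          using hk' R0 by (auto simp: \<theta>_def field_simps)
        then have "I \<le> m + F (a + R *\<^sub>R h') (b + R *\<^sub>R k')" by (rule I_closed)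
        also have "F (a + R *\<^sub>R h') (b + R *\<^sub>R k')
            = S * coupling_barrier \<kappa> K \<theta> (s a b + (h' - k')) (w a b + (h' + k'))"
          using R0 by (simp add: F_def shift)
        finally have "F x' z' + I \<le> m + S * (coupling_barrier \<kappa> K \<theta> (s a b + (h - k)) (w a b + (h + k))
             + coupling_barrier \<kappa> K \<theta> (s a b + (h' - k')) (w a b + (h' + k')))"
          unfolding F' distrib_left by linarith
        also have "\<dots> \<le> m + S * (2 * coupling_barrier \<kappa> K \<theta> (s a b) (w a b) - \<Lambda> * \<theta>\<^sup>2)"
          using le S by (intro add_left_mono mult_left_mono) auto
        also have "\<dots> = m + 2 * F a b - S * (\<Lambda> * \<theta>\<^sup>2)" by (simp add: F_def algebra_simps)
        finally show "F x' z' + I \<le> m + 2 * F a b - S * (\<Lambda> * \<theta>\<^sup>2)" .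
      qed
    qed
  qed
  also have "\<dots> = (\<alpha> + \<beta>) * (m + F a b) - (\<alpha> * \<Lambda> / 2 - 4 * \<beta>) * (S * \<theta>\<^sup>2)"
    by (simp add: field_simps)
  also have "\<alpha> * \<Lambda> / 2 - 4 * \<beta> = \<alpha>" using alpha_pos by (simp add: \<Lambda>_def field_simps)
  finally show False using Gm by (simp add: alpha_beta mult.assoc)
qed


text \<open>
  The modulus of continuity in the form used below: the oscillation on a ball is a small
  fraction of the supremum over a ball that is \<open>L\<close> times larger, with a fraction that tends to \<open>0\<close> as
  \<open>L\<close> grows, uniformly in the step size.
\<close>

lemma oscillation_small:
  assumes \<kappa>: "0 < \<kappa>" "\<kappa> \<le> 1 / 10000" and K: "K * \<kappa> \<ge> 4000 * (10 + 8 * \<beta> / \<alpha>)"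
    and L: "1 \<le> L" and r: "\<epsilon> \<le> r"
    and dom: "ball x\<^sub>0 (L * r + \<epsilon>) \<subseteq> \<Omega>" and S: "0 < S"
    and uS: "\<And>y. y \<in> ball x\<^sub>0 (L * r + \<epsilon>) \<Longrightarrow> u y \<le> S"
    and z: "z \<in> ball x\<^sub>0 r"
  shows "u x\<^sub>0 - u z \<le> S * (K * (2 / L\<^sup>2) powr \<kappa> + 1 / L\<^sup>2)"
proof -
  define R where "R = L * r"
  have r0: "0 < r" using r eps_pos by linarith
  have rR: "r \<le> R" using L r0 by (simp add: R_def)
  have K0: "0 \<le> K"
  proof -
    have "0 \<le> 4000 * (10 + 8 * \<beta> / \<alpha>)" using alpha_pos beta_pos by simp
    then have "0 \<le> K * \<kappa>" using K by (rule order_trans)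
    then show ?thesis using \<kappa> by (simp add: zero_le_mult_iff)
  qed
  have small: "(norm ((z - x\<^sub>0) /\<^sub>R R))\<^sup>2 \<le> 1 / L\<^sup>2" "(\<epsilon> / R)\<^sup>2 \<le> 1 / L\<^sup>2"
  proof -
    have "norm (z - x\<^sub>0) \<le> r" using z by (simp add: dist_norm norm_minus_commute)
    then have "norm (z - x\<^sub>0) / R \<le> r / R" using rR r0 by (intro divide_right_mono) auto
    moreover have "norm ((z - x\<^sub>0) /\<^sub>R R) = norm (z - x\<^sub>0) / R"
      using rR r0 by (simp add: divide_inverse mult.commute)
    moreover have "r / R = 1 / L" using r0 by (simp add: R_def)
    ultimately have "norm ((z - x\<^sub>0) /\<^sub>R R) \<le> 1 / L" by simp
    then have "(norm ((z - x\<^sub>0) /\<^sub>R R))\<^sup>2 \<le> (1 / L)\<^sup>2" by (intro power_mono) auto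
    then show "(norm ((z - x\<^sub>0) /\<^sub>R R))\<^sup>2 \<le> 1 / L\<^sup>2" by (simp add: power_one_over)
    have "\<epsilon> / R \<le> 1 / L" using r L r0 by (simp add: R_def field_simps)
    then have "(\<epsilon> / R)\<^sup>2 \<le> (1 / L)\<^sup>2" using eps_pos rR r0 by (intro power_mono) auto
    then show "(\<epsilon> / R)\<^sup>2 \<le> 1 / L\<^sup>2" by (simp add: power_one_over)
  qed
  have "u x\<^sub>0 - u z \<le> S * coupling_barrier \<kappa> K (\<epsilon> / R) ((x\<^sub>0 - z) /\<^sub>R R) ((x\<^sub>0 + z - 2 *\<^sub>R x\<^sub>0) /\<^sub>R R)"
    by (rule oscillation_bound[OF \<kappa> K]) (use dom S uS z rR r r0 eps_pos in \<open>auto simp: R_def[symmetric]\<close>)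
  also have "\<dots> \<le> S * (K * (2 / L\<^sup>2) powr \<kappa> + 1 / L\<^sup>2)"
  proof (rule mult_left_mono)
    have e: "(norm ((x\<^sub>0 - z) /\<^sub>R R))\<^sup>2 = (norm ((z - x\<^sub>0) /\<^sub>R R))\<^sup>2"
      by (simp add: norm_minus_commute)
    have w: "x\<^sub>0 + z - 2 *\<^sub>R x\<^sub>0 = z - x\<^sub>0" by (simp add: scaleR_2)
    have "((norm ((z - x\<^sub>0) /\<^sub>R R))\<^sup>2 + (\<epsilon> / R)\<^sup>2) powr \<kappa> \<le> (2 / L\<^sup>2) powr \<kappa>"
      using small \<kappa> by (intro powr_mono2) auto
    then have "K * ((norm ((z - x\<^sub>0) /\<^sub>R R))\<^sup>2 + (\<epsilon> / R)\<^sup>2) powr \<kappa> \<le> K * (2 / L\<^sup>2) powr \<kappa>"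
      using K0 by (rule mult_left_mono)
    then show "coupling_barrier \<kappa> K (\<epsilon> / R) ((x\<^sub>0 - z) /\<^sub>R R) ((x\<^sub>0 + z - 2 *\<^sub>R x\<^sub>0) /\<^sub>R R)
        \<le> K * (2 / L\<^sup>2) powr \<kappa> + 1 / L\<^sup>2"
      unfolding coupling_barrier_def w e using small(1) by (rule add_mono)
  qed (use S in simp)
  finally show ?thesis .
qed

end

section \<open>Growth away from a ball\<close>

lemma inverse_power_ge:
  fixes \<xi> :: real
  assumes "-1 < \<xi>"
  shows "1 - real j * \<xi> \<le> 1 / (1 + \<xi>) ^ j"
proof -
  have "1 - 1 / (1 + \<xi>) \<le> \<xi>" using assms by (simp add: field_simps)
  then have "real j * (1 - 1 / (1 + \<xi>)) \<le> real j * \<xi>" by (intro mult_left_mono) auto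
  then have "1 - real j * \<xi> \<le> 1 + real j * (1 / (1 + \<xi>) - 1)" by (simp add: algebra_simps)
  also have "\<dots> \<le> (1 + (1 / (1 + \<xi>) - 1)) ^ j"
    using assms by (intro Bernoulli_inequality) simp
  finally show ?thesis by (simp add: power_one_over)
qed

text \<open>
  The gain of order \<open>j\<^sup>2\<close> that makes negative powers subsolutions. With \<open>a\<close> and \<open>b\<close> the two powers
  of order \<open>j\<close>, one has \<open>a\<^sup>2 + b\<^sup>2 = (a - b)\<^sup>2 + 2 a b\<close>, where \<open>a b \<ge> 1\<close> and, by Bernoulli's inequality,
  \<open>a - b \<ge> j z\<close>.
\<close>

lemma inverse_power_second_difference:
  fixes z :: real
  assumes "0 \<le> z" "z < 1"
  shows "2 + (real j * z)\<^sup>2 \<le> 1 / (1 - z) ^ (2 * j) + 1 / (1 + z) ^ (2 * j)"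
proof -
  define a b where "a = 1 / (1 - z) ^ j" and "b = 1 / (1 + z) ^ j"
  define y where "y = real j * z"
  have y: "0 \<le> y" using assms by (simp add: y_def)
  have a: "1 + y \<le> a" using inverse_power_ge[of "- z" j] assms by (simp add: a_def y_def)
  have "1 + y \<le> (1 + z) ^ j" using Bernoulli_inequality[of z j] assms by (simp add: y_def)
  then have b: "b \<le> 1 / (1 + y)" unfolding b_def using y by (intro divide_left_mono) (auto intro!: mult_pos_pos)
  have "1 / (1 + y) \<le> 1" using y by simp
  then have "y \<le> a - b" using a b by linarith
  then have "y\<^sup>2 \<le> (a - b)\<^sup>2" using y by (intro power_mono) auto
  moreover have "1 \<le> a * b"
  proof -
    have "(1 - z) * (1 + z) \<le> 1" using assms by (simp add: algebra_simps)
    then have "((1 - z) * (1 + z)) ^ j \<le> 1" using assms by (intro power_le_one) auto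
    moreover have "0 < ((1 - z) * (1 + z)) ^ j" using assms by simp
    moreover have "a * b = 1 / ((1 - z) * (1 + z)) ^ j" by (simp add: a_def b_def power_mult_distrib)
    ultimately show ?thesis by (simp only: le_divide_eq_1_pos)
  qed
  moreover have "a\<^sup>2 + b\<^sup>2 = (a - b)\<^sup>2 + 2 * (a * b)" by (simp add: power2_eq_square algebra_simps)
  ultimately have "2 + y\<^sup>2 \<le> a\<^sup>2 + b\<^sup>2" by linarith
  then show ?thesis by (simp add: a_def b_def y_def power_divide mult.commute flip: power_mult)
qed

text \<open>
  As a function of the squared norm, the negative power is convex and lies above its tangent. The
  squared norm is affine in \<open>h\<close> up to \<open>(norm h)\<^sup>2 \<le> \<epsilon>\<^sup>2\<close>, so averaging over \<open>h\<close> costs only a term of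
  order \<open>j\<close>.
\<close>

lemma inverse_norm_power_affine_lower:
  fixes v h :: "'a::real_inner"
  assumes h: "norm h \<le> \<epsilon>" and \<epsilon>: "\<epsilon> < norm v"
  shows "1 / norm v ^ (2 * j) * (1 - real j * (\<epsilon> / norm v)\<^sup>2)
         + (- 2 * real j / norm v ^ (2 * j) / (norm v)\<^sup>2) *\<^sub>R v \<bullet> h
       \<le> 1 / norm (v + h) ^ (2 * j)"
proof -
  define t where "t = norm v"
  have t: "0 < t" using h \<epsilon> norm_ge_zero[of h] unfolding t_def by linarith
  define \<xi> where "\<xi> = (2 * (v \<bullet> h) + (norm h)\<^sup>2) / t\<^sup>2"
  have sq: "(norm (v + h))\<^sup>2 = t\<^sup>2 * (1 + \<xi>)"
    using t by (auto simp add: norm_add_sq inner_commute \<xi>_def t_def[symmetric] field_simps)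
  have "0 < norm (v + h)" using norm_diff_ineq[of v h] h \<epsilon> by linarith
  then have "0 < t\<^sup>2 * (1 + \<xi>)" using sq by (metis zero_less_power)
  then have \<xi>1: "-1 < \<xi>" using t by (simp add: zero_less_mult_iff)
  have "\<xi> \<le> 2 * (v \<bullet> h) / t\<^sup>2 + (\<epsilon> / t)\<^sup>2"
  proof -
    have "(norm h)\<^sup>2 / t\<^sup>2 \<le> \<epsilon>\<^sup>2 / t\<^sup>2" using h by (intro divide_right_mono power_mono) auto
    then show ?thesis by (simp add: \<xi>_def add_divide_distrib power_divide)
  qed
  then have "real j * \<xi> \<le> real j * (2 * (v \<bullet> h) / t\<^sup>2 + (\<epsilon> / t)\<^sup>2)" by (intro mult_left_mono) auto
  then have "1 - real j * (2 * (v \<bullet> h) / t\<^sup>2 + (\<epsilon> / t)\<^sup>2) \<le> 1 / (1 + \<xi>) ^ j"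
    using inverse_power_ge[OF \<xi>1, of j] by linarith
  then have "1 / t ^ (2 * j) * (1 - real j * (2 * (v \<bullet> h) / t\<^sup>2 + (\<epsilon> / t)\<^sup>2)) \<le> 1 / t ^ (2 * j) * (1 / (1 + \<xi>) ^ j)"
    using t by (intro mult_left_mono) auto
  also have "\<dots> = 1 / norm (v + h) ^ (2 * j)"
    unfolding power_mult sq by (simp add: power_mult_distrib)
  finally show ?thesis unfolding t_def[symmetric] by (simp add: algebra_simps)
qed

context tug_of_war_solution
begin

text \<open>
  By positivity, the infimum and the average may be dropped from the dynamic programming principle.
\<close>

lemma ball_le:
  assumes x: "ball x \<epsilon> \<subseteq> \<Omega>" and y: "dist x y < \<epsilon>"
  shows "\<alpha> / 2 * u y \<le> u x"
proof -
  have "0 + (\<alpha> / 2 * (0 + u y) + \<beta> * 0) \<le> u x"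
  proof (rule one_step_lower[OF x, where w = 0])
    show "0 + u y \<le> (SUP y\<in>ball x \<epsilon>. u y)"
      using y bdd_image[OF x] by (simp add: cSUP_upper)
    show "0 + 0 \<le> u y" if "y \<in> ball x \<epsilon>" for y using pos[of y] x that by auto
    show "0 + 0 + 0 \<bullet> h \<le> u (x + h)" if "norm h < \<epsilon>" for h
      using pos[of "x + h"] x that by (force simp: dist_norm)
  qed
  then show ?thesis by simp
qed

text \<open>
  Comparison with the subsolution \<open>v\<close>, a multiple of \<open>norm (y - x\<^sub>0) ^ (- 2 j)\<close> shifted so as to
  vanish on the sphere of radius \<open>4\<close>, which encloses the origin. The comparison takes place on an
  annulus \<open>E\<close> from which the pole is removed. It is enlarged on either side of the region where the
  dynamic programming principle is used, so that no step leaves it: \<open>2 \<epsilon> \<le> r\<close> keeps the steps out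
  of the ball of radius \<open>r / 2\<close>, and the factor \<open>\<mu>\<close> is chosen such that \<open>v \<le> m\<close> outside that ball.
\<close>

lemma growth_from_ball:
  assumes dom: "ball 0 10 \<subseteq> \<Omega>" and j: "2 * \<beta> < \<alpha> * real j"
    and x\<^sub>0: "norm x\<^sub>0 < 2" and r: "2 * \<epsilon> \<le> r" "r \<le> 1" and m: "0 < m"
    and ge: "\<And>y. y \<in> ball x\<^sub>0 r \<Longrightarrow> m \<le> u y"
  shows "m * (r / 8) ^ (2 * j) \<le> u 0"
proof (cases "norm x\<^sub>0 < r")
  case True
  have "m * (r / 8) ^ (2 * j) \<le> m * 1"
    using m r eps_pos by (intro mult_left_mono power_le_one) auto
  also have "\<dots> \<le> u 0" using ge[of 0] True by simp
  finally show ?thesis .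
next
  case False
  define \<mu> where "\<mu> = m * (r / 2) ^ (2 * j)"
  define v where "v y = \<mu> * (1 / norm (y - x\<^sub>0) ^ (2 * j) - 1 / 4 ^ (2 * j))" for y
  have r0: "0 < r" using r eps_pos by linarith
  have \<mu>: "0 < \<mu>" using m r0 by (simp add: \<mu>_def)
  have j0: "0 < real j"
  proof (rule ccontr)
    assume "\<not> 0 < real j"
    then show False using j beta_pos by simp
  qed
  define E where "E = {y. r / 2 \<le> norm (y - x\<^sub>0) \<and> norm (y - x\<^sub>0) < 5}"
  have E\<Omega>: "E \<subseteq> \<Omega>"
  proof
    fix y assume "y \<in> E"
    then have "norm y < 10" using norm_triangle_ineq[of "y - x\<^sub>0" x\<^sub>0] x\<^sub>0 by (simp add: E_def)
    then show "y \<in> \<Omega>" using dom by auto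
  qed
  have v_le_m: "v y \<le> m" if "y \<in> E" for y
  proof -
    have "(r / 2) ^ (2 * j) \<le> norm (y - x\<^sub>0) ^ (2 * j)"
      using that r0 by (intro power_mono) (auto simp: E_def)
    then have "1 / norm (y - x\<^sub>0) ^ (2 * j) \<le> 1 / (r / 2) ^ (2 * j)"
      using r0 that by (intro divide_left_mono mult_pos_pos zero_less_power) (auto simp: E_def)
    then have "1 / norm (y - x\<^sub>0) ^ (2 * j) - 1 / 4 ^ (2 * j) \<le> 1 / (r / 2) ^ (2 * j)"
      by (rule order_trans[rotated]) simp
    then have "v y \<le> \<mu> * (1 / (r / 2) ^ (2 * j))"
      unfolding v_def using \<mu> by (intro mult_left_mono) auto
    also have "\<dots> = m" using r0 by (simp add: \<mu>_def)
    finally show ?thesis .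
  qed
  define G where "G y = u y - v y" for y
  have G_low: "- m \<le> G y" if "y \<in> E" for y
    using v_le_m[OF that] pos[of y] E\<Omega> that by (auto simp: G_def)
  then have bddG: "bdd_below (G ` E)" by (intro bdd_belowI2[where m = "- m"])
  define m\<^sub>0 where "m\<^sub>0 = Inf (G ` E)"
  have low: "m\<^sub>0 + v y \<le> u y" if "y \<in> E" for y
    using cINF_lower[OF bddG that] by (simp add: m\<^sub>0_def G_def)
  have zero: "0 \<in> E" using False x\<^sub>0 r0 by (simp add: E_def)
  \<comment> \<open>The amount by which the subsolution is strict, bounded below on the annulus by means of \<open>t < 4\<close>.\<close>
  define \<delta> where "\<delta> = \<mu> * (1 / 4 ^ (2 * j) * (real j / 2 * (\<alpha> * real j - 2 * \<beta>) * (\<epsilon> / 4)\<^sup>2))"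
  have \<delta>: "0 < \<delta>" using \<mu> j0 j eps_pos by (simp add: \<delta>_def)
  have "0 \<le> m\<^sub>0"
  proof (rule ccontr)
    assume "\<not> 0 \<le> m\<^sub>0"
    then have "Inf (G ` E) < min 0 (m\<^sub>0 + \<delta>)" using \<delta> by (simp add: m\<^sub>0_def)
    then obtain y where y: "y \<in> E" "G y < min 0 (m\<^sub>0 + \<delta>)"
      using zero by (subst (asm) cInf_less_iff) (use bddG in auto)
    define t where "t = norm (y - x\<^sub>0)"
    have t4: "t < 4"
    proof (rule ccontr)
      assume "\<not> t < 4"
      then have "4 ^ (2 * j) \<le> t ^ (2 * j)" by (intro power_mono) auto
      then have "1 / t ^ (2 * j) \<le> 1 / 4 ^ (2 * j)"
        by (intro divide_left_mono mult_pos_pos) (use \<open>\<not> t < 4\<close> in auto)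
      then have "v y \<le> 0" using \<mu> by (simp add: v_def t_def mult_le_0_iff)
      then show False using pos[of y] E\<Omega> y by (auto simp: G_def)
    qed
    have rt: "r \<le> t"
    proof (rule ccontr)
      assume "\<not> r \<le> t"
      then have "m \<le> u y" using ge[of y] by (simp add: t_def dist_norm norm_minus_commute)
      then show False using v_le_m[OF y(1)] y by (simp add: G_def)
    qed
    have t0: "0 < t" using rt r0 by linarith
    define z where "z = \<epsilon> / t"
    have z: "0 < z" "z < 1" using eps_pos t0 r rt by (auto simp: z_def divide_less_eq)
    have ballE: "ball y \<epsilon> \<subseteq> E"
    proof
      fix y' assume "y' \<in> ball y \<epsilon>"
      then have d: "norm (y' - y) < \<epsilon>" by (simp add: dist_norm norm_minus_commute)
      have "norm (y' - x\<^sub>0) \<le> t + norm (y' - y)" "t - norm (y' - y) \<le> norm (y' - x\<^sub>0)"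
        using norm_triangle_ineq[of "y - x\<^sub>0" "y' - y"] norm_diff_ineq[of "y - x\<^sub>0" "y' - y"]
        by (auto simp: t_def)
      then show "y' \<in> E" using d t4 rt r by (auto simp: E_def)
    qed
    define a b c where "a = \<mu> * (1 / (t + \<epsilon>) ^ (2 * j) - 1 / 4 ^ (2 * j))"
      and "b = \<mu> * (1 / (t - \<epsilon>) ^ (2 * j) - 1 / 4 ^ (2 * j))"
      and "c = \<mu> * (1 / t ^ (2 * j) * (1 - real j * z\<^sup>2) - 1 / 4 ^ (2 * j))"
    have "m\<^sub>0 + (\<alpha> / 2 * (a + b) + \<beta> * c) \<le> u y"
    proof (rule one_step_lower[where w = "(\<mu> * (- 2 * real j / t ^ (2 * j) / t\<^sup>2)) *\<^sub>R (y - x\<^sub>0)"])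
      show "ball y \<epsilon> \<subseteq> \<Omega>" using ballE E\<Omega> by blast
      show "m\<^sub>0 + c + (\<mu> * (- 2 * real j / t ^ (2 * j) / t\<^sup>2)) *\<^sub>R (y - x\<^sub>0) \<bullet> h \<le> u (y + h)"
        if h: "norm h < \<epsilon>" for h
      proof -
        have "\<mu> * (1 / t ^ (2 * j) * (1 - real j * z\<^sup>2)
              + (- 2 * real j / t ^ (2 * j) / t\<^sup>2) *\<^sub>R (y - x\<^sub>0) \<bullet> h)
            \<le> \<mu> * (1 / norm (y - x\<^sub>0 + h) ^ (2 * j))"
          unfolding z_def t_def
          by (intro mult_left_mono inverse_norm_power_affine_lower)
             (use h \<mu> r rt eps_pos in \<open>auto simp: t_def\<close>)
        moreover have "m\<^sub>0 + v (y + h) \<le> u (y + h)"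
          using ballE h by (intro low) (auto simp: dist_norm)
        moreover have "y + h - x\<^sub>0 = y - x\<^sub>0 + h" by simp
        ultimately show ?thesis by (simp add: c_def v_def algebra_simps)
      qed
      show "m\<^sub>0 + a \<le> u y'" if y': "y' \<in> ball y \<epsilon>" for y'
      proof -
        have "norm (y' - x\<^sub>0) \<le> t + \<epsilon>"
          using norm_triangle_ineq[of "y - x\<^sub>0" "y' - y"] y'
          by (simp add: t_def dist_norm norm_minus_commute)
        then have "norm (y' - x\<^sub>0) ^ (2 * j) \<le> (t + \<epsilon>) ^ (2 * j)" by (intro power_mono) auto
        moreover have "0 < norm (y' - x\<^sub>0)" using ballE y' r0 by (force simp: E_def)
        ultimately have "1 / (t + \<epsilon>) ^ (2 * j) \<le> 1 / norm (y' - x\<^sub>0) ^ (2 * j)"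
          using t0 eps_pos by (intro divide_left_mono mult_pos_pos zero_less_power) auto
        then have "a \<le> v y'" unfolding a_def v_def using \<mu> by (intro mult_left_mono) auto
        then show ?thesis using low ballE y' by fastforce
      qed
      \<comment> \<open>The step of length \<open>\<epsilon>\<close> towards \<open>x\<^sub>0\<close> is only a limit of admissible steps of length \<open>c < \<epsilon>\<close>.\<close>
      show "m\<^sub>0 + b \<le> (SUP y\<in>ball y \<epsilon>. u y)"
      proof (rule tendsto_upperbound)
        have "isCont (\<lambda>c. m\<^sub>0 + \<mu> * (1 / (t - c) ^ (2 * j) - 1 / 4 ^ (2 * j))) \<epsilon>"
          using rt r eps_pos by (intro continuous_intros) auto
        then show "((\<lambda>c. m\<^sub>0 + \<mu> * (1 / (t - c) ^ (2 * j) - 1 / 4 ^ (2 * j))) \<longlongrightarrow> m\<^sub>0 + b) (at_left \<epsilon>)"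
          by (simp add: isCont_def filterlim_at_split b_def)
        have "m\<^sub>0 + \<mu> * (1 / (t - c) ^ (2 * j) - 1 / 4 ^ (2 * j)) \<le> (SUP y\<in>ball y \<epsilon>. u y)"
          if c: "0 < c" "c < \<epsilon>" for c
        proof -
          define y' where "y' = y - (c / t) *\<^sub>R (y - x\<^sub>0)"
          have "norm (y - y') = c" using t0 c by (simp add: y'_def t_def)
          then have y': "y' \<in> ball y \<epsilon>" using c by (simp add: dist_norm)
          have "y' - x\<^sub>0 = (1 - c / t) *\<^sub>R (y - x\<^sub>0)" by (simp add: y'_def algebra_simps)
          then have "norm (y' - x\<^sub>0) = \<bar>1 - c / t\<bar> * t" by (simp add: t_def)
          also have "\<dots> = t - c" using t0 c r rt by (simp add: abs_if field_simps)
          finally have "m\<^sub>0 + \<mu> * (1 / (t - c) ^ (2 * j) - 1 / 4 ^ (2 * j)) = m\<^sub>0 + v y'"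
            by (simp add: v_def)
          also have "\<dots> \<le> u y'" using low ballE y' by blast
          also have "\<dots> \<le> (SUP y\<in>ball y \<epsilon>. u y)"
            by (rule cSUP_upper[OF y']) (use bdd_image[OF order_trans[OF ballE E\<Omega>]] in simp)
          finally show ?thesis .
        qed
        then show "\<forall>\<^sub>F c in at_left \<epsilon>. m\<^sub>0 + \<mu> * (1 / (t - c) ^ (2 * j) - 1 / 4 ^ (2 * j)) \<le> (SUP y\<in>ball y \<epsilon>. u y)"
          using eps_pos by (intro eventually_at_leftI[of 0]) auto
      qed simp
    qed
    moreover have "v y + \<delta> \<le> \<alpha> / 2 * (a + b) + \<beta> * c"
    proof -
      define T where "T = 1 / t ^ (2 * j)"
      define d where "d = 1 / (4::real) ^ (2 * j)"
      have T0: "0 < T" using t0 by (simp add: T_def)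
      have "t + \<epsilon> = t * (1 + z)" "t - \<epsilon> = t * (1 - z)" using t0 by (simp_all add: z_def field_simps)
      then have "(t + \<epsilon>) ^ (2 * j) = t ^ (2 * j) * (1 + z) ^ (2 * j)"
        "(t - \<epsilon>) ^ (2 * j) = t ^ (2 * j) * (1 - z) ^ (2 * j)"
        by (simp_all only: power_mult_distrib)
      then have ab: "a + b = \<mu> * (T * (1 / (1 - z) ^ (2 * j) + 1 / (1 + z) ^ (2 * j)) - 2 * d)"
        by (simp add: a_def b_def T_def d_def algebra_simps)
      have "\<mu> * (T * (2 + (real j * z)\<^sup>2) - 2 * d) \<le> a + b"
        unfolding ab using \<mu> T0 z inverse_power_second_difference[of z j]
        by (intro mult_left_mono diff_right_mono) auto
      then have "\<alpha> / 2 * (\<mu> * (T * (2 + (real j * z)\<^sup>2) - 2 * d)) + \<beta> * c \<le> \<alpha> / 2 * (a + b) + \<beta> * c"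
        using alpha_pos by simp
      moreover have "\<alpha> / 2 * (\<mu> * (T * (2 + (real j * z)\<^sup>2) - 2 * d)) + \<beta> * c
          = (\<alpha> + \<beta>) * (\<mu> * (T - d)) + \<mu> * (T * (real j / 2 * (\<alpha> * real j - 2 * \<beta>) * z\<^sup>2))"
      proof -
        have "c = \<mu> * (T * (1 - real j * z\<^sup>2) - d)" by (simp add: c_def T_def d_def)
        then show ?thesis by (simp only:) (simp add: field_simps power2_eq_square)
      qed
      moreover have "(\<alpha> + \<beta>) * (\<mu> * (T - d)) = v y"
        by (simp add: alpha_beta v_def T_def d_def t_def)
      moreover have "\<delta> \<le> \<mu> * (T * (real j / 2 * (\<alpha> * real j - 2 * \<beta>) * z\<^sup>2))"
      proof -
        have "t ^ (2 * j) \<le> 4 ^ (2 * j)" using t0 t4 by (intro power_mono) auto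
        then have "1 / 4 ^ (2 * j) \<le> T" unfolding T_def using t0 by (intro divide_left_mono) auto
        moreover have "\<epsilon> / 4 \<le> z" unfolding z_def using t0 t4 eps_pos by (intro divide_left_mono) auto
        then have "(\<epsilon> / 4)\<^sup>2 \<le> z\<^sup>2" using eps_pos by (intro power_mono) auto
        ultimately show ?thesis unfolding \<delta>_def
          using \<mu> j j0 T0 by (intro mult_left_mono mult_mono) auto
      qed
      ultimately show ?thesis by linarith
    qed
    ultimately show False using y by (simp add: G_def)
  qed
  then have "v 0 \<le> u 0" using low[OF zero] by linarith
  moreover have "m * (r / 8) ^ (2 * j) \<le> v 0"
  proof -
    have "norm x\<^sub>0 ^ (2 * j) \<le> 2 ^ (2 * j)" using x\<^sub>0 by (intro power_mono) auto
    then have "1 / 2 ^ (2 * j) \<le> 1 / norm x\<^sub>0 ^ (2 * j)"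
      using False r0 by (intro divide_left_mono mult_pos_pos zero_less_power) auto
    moreover have "2 * (1 / 4 ^ (2 * j)) \<le> 1 / (2::real) ^ (2 * j)"
    proof -
      have "(2::real) ^ 1 \<le> 2 ^ (2 * j)" using j0 by (intro power_increasing) auto
      moreover have "(4::real) ^ (2 * j) = 2 ^ (2 * j) * 2 ^ (2 * j)" by (simp flip: power_mult_distrib)
      ultimately show ?thesis by (simp add: field_simps)
    qed
    ultimately have "1 / 4 ^ (2 * j) \<le> 1 / norm x\<^sub>0 ^ (2 * j) - 1 / 4 ^ (2 * j)" by linarith
    then have "\<mu> * (1 / 4 ^ (2 * j)) \<le> v 0"
      unfolding v_def using \<mu> by (intro mult_left_mono) auto
    moreover have "\<mu> * (1 / 4 ^ (2 * j)) = m * (r / 8) ^ (2 * j)"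
      by (simp add: \<mu>_def power_divide flip: power_mult_distrib)
    ultimately show ?thesis by simp
  qed
  ultimately show ?thesis by linarith
qed

end

section \<open>The Harnack chain\<close>

context tug_of_war_solution
begin

text \<open>
  The hypothesis on \<open>L\<close> makes the oscillation estimate incompatible with the factor \<open>4 ^ j\<close> in the
  chain of points, and \<open>r\<^sub>0\<close> is so small that the whole chain, of length at most
  \<open>2 (L + 1) r\<^sub>0 = 1/2\<close>, stays in the ball of radius \<open>2\<close>. In the constant, \<open>64 ^ j = 8 ^ (2 j)\<close> comes
  from the growth estimate; the summand \<open>2\<close> serves the inner steps of the chain and \<open>4 / \<alpha>\<^sup>2\<close> the two
  one-step losses at its end.
\<close>

lemma harnack_sup_bound:
  assumes dom: "ball 0 10 \<subseteq> \<Omega>" and norm0: "u 0 = 1"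
    and \<kappa>: "0 < \<kappa>" "\<kappa> \<le> 1 / 10000" and K: "K * \<kappa> \<ge> 4000 * (10 + 8 * \<beta> / \<alpha>)"
    and j: "2 * \<beta> < \<alpha> * real j"
    and L: "1 \<le> L" "K * (2 / L\<^sup>2) powr \<kappa> + 1 / L\<^sup>2 \<le> 1 / (4 * 4 ^ j)"
    and r\<^sub>0: "r\<^sub>0 = 1 / (4 * (L + 1))" and eps: "\<epsilon> \<le> r\<^sub>0" and x: "norm x < 1"
  shows "u x \<le> (2 + 4 / \<alpha>\<^sup>2) * 64 ^ j / r\<^sub>0 ^ (2 * j)"
proof (rule ccontr)
  define A where "A = (2 + 4 / \<alpha>\<^sup>2) * 64 ^ j"
  have A: "0 < A" using alpha_pos by (simp add: A_def add_pos_pos)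
  have r0: "0 < r\<^sub>0" using L by (simp add: r\<^sub>0)
  have Lr0: "(L + 1) * r\<^sub>0 = 1 / 4" using L by (simp add: r\<^sub>0 field_simps)
  have r01: "r\<^sub>0 \<le> 1 / 8" using L by (simp add: r\<^sub>0 field_simps)
  have p64: "(c / 8) ^ (2 * j) = c ^ (2 * j) / 64 ^ j" for c :: real
    by (simp add: power_divide power_mult)
  assume "\<not> u x \<le> (2 + 4 / \<alpha>\<^sup>2) * 64 ^ j / r\<^sub>0 ^ (2 * j)"
  then have start: "A / r\<^sub>0 ^ (2 * j) < u x" by (simp add: A_def)
  \<comment> \<open>The bound on \<open>norm y\<close> is the partial sum of the displacements \<open>(L + 1) r\<^sub>0 / 2 ^ i\<close>, \<open>i < k\<close>.\<close>
  have chain: "\<exists>y. norm y < 1 + 2 * (L + 1) * (r\<^sub>0 - r\<^sub>0 / 2 ^ k) \<and> A / (r\<^sub>0 / 2 ^ k) ^ (2 * j) < u y"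
    if "\<epsilon> \<le> r\<^sub>0 / 2 ^ k" for k
    using that
  proof (induction k)
    case 0
    then show ?case using x start by auto
  next
    case (Suc k)
    define r where "r = r\<^sub>0 / 2 ^ k"
    have half: "r\<^sub>0 / 2 ^ Suc k = r / 2" by (simp add: r_def)
    have r: "0 < r" "2 * \<epsilon> \<le> r" using Suc.prems r0 unfolding half by (auto simp: r_def)
    have r_le: "r \<le> r\<^sub>0" using r0 by (simp add: r_def divide_le_eq)
    obtain y where y: "norm y < 1 + 2 * (L + 1) * (r\<^sub>0 - r)" "A / r ^ (2 * j) < u y"
      using Suc.IH r eps_pos unfolding r_def by auto
    have "(L + 1) * r \<le> 1 / 4" using mult_left_mono[OF r_le, of "L + 1"] L Lr0 by simp
    moreover have "0 < (L + 1) * r" using L r by simp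
    moreover have "2 * (L + 1) * (r\<^sub>0 - r) = 2 * ((L + 1) * r\<^sub>0) - 2 * ((L + 1) * r)"
      by (simp add: algebra_simps)
    ultimately have y2: "norm y < 2" and Lr: "(L + 1) * r \<le> 1 / 4" using y Lr0 by linarith+
    have LR: "L * r + \<epsilon> \<le> (L + 1) * r" using r eps_pos by (simp add: distrib_right)
    define m where "m = A / r ^ (2 * j) / 2"
    have m0: "0 < m" using A r by (simp add: m_def)
    have "\<exists>z\<in>ball y r. u z < m"
    proof (rule ccontr)
      assume "\<not> (\<exists>z\<in>ball y r. u z < m)"
      then have "m * (r / 8) ^ (2 * j) \<le> u 0"
        using r r_le r01 by (intro growth_from_ball[OF dom j y2 _ _ m0]) (auto simp: not_less)
      moreover have "m * (r / 8) ^ (2 * j) = A / 64 ^ j / 2"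
        using r by (simp add: m_def p64)
      moreover have "A / 64 ^ j = 2 + 4 / \<alpha>\<^sup>2" by (simp add: A_def)
      ultimately show False using norm0 alpha_pos by simp
    qed
    then obtain z where z: "z \<in> ball y r" "u z < m" by blast
    have ballO: "ball y (L * r + \<epsilon>) \<subseteq> \<Omega>"
    proof
      fix v assume "v \<in> ball y (L * r + \<epsilon>)"
      then have "norm v < 10"
        using norm_triangle_ineq[of y "v - y"] y2 LR Lr by (simp add: dist_norm norm_minus_commute)
      then show "v \<in> \<Omega>" using dom by auto
    qed
    \<comment> \<open>The value that the next point of the chain has to exceed.\<close>
    define S where "S = A / (r / 2) ^ (2 * j)"
    have S4: "S = 4 ^ j * (A / r ^ (2 * j))"
      by (simp add: S_def power_divide power_mult)
    have "\<exists>y'\<in>ball y (L * r + \<epsilon>). S < u y'"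
    proof (rule ccontr)
      assume "\<not> (\<exists>y'\<in>ball y (L * r + \<epsilon>). S < u y')"
      then have le: "\<And>y'. y' \<in> ball y (L * r + \<epsilon>) \<Longrightarrow> u y' \<le> S" by (auto simp: not_less)
      have S0: "0 < S" using A r by (simp add: S4)
      have "u y - u z \<le> S * (K * (2 / L\<^sup>2) powr \<kappa> + 1 / L\<^sup>2)"
        by (rule oscillation_small[OF \<kappa> K L(1) _ ballO S0 le z(1)]) (use r eps_pos in auto)
      also have "\<dots> \<le> S * (1 / (4 * 4 ^ j))" using L(2) S0 by (intro mult_left_mono) auto
      also have "\<dots> = m / 2" by (simp add: S4 m_def)
      finally show False using y z m0 by (simp add: m_def)
    qed
    then obtain y' where y': "y' \<in> ball y (L * r + \<epsilon>)" "S < u y'" by blast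
    have "norm y' < norm y + (L + 1) * r"
      using y'(1) LR norm_triangle_ineq[of y "y' - y"] by (simp add: dist_norm norm_minus_commute)
    moreover have "2 * (L + 1) * (r\<^sub>0 - r) + (L + 1) * r = 2 * (L + 1) * (r\<^sub>0 - r / 2)"
      by (simp add: algebra_simps)
    ultimately have "norm y' < 1 + 2 * (L + 1) * (r\<^sub>0 - r / 2)" using y(1) by linarith
    then show ?case using y'(2) unfolding half S_def by blast
  qed
  \<comment> \<open>The chain is followed down to the last radius that is not below the step size.\<close>
  obtain k where k: "\<epsilon> \<le> r\<^sub>0 / 2 ^ k" "r\<^sub>0 / 2 ^ k < 2 * \<epsilon>"
  proof -
    obtain n where "(1/2) ^ n < 2 * \<epsilon> / r\<^sub>0"
      using real_arch_pow_inv[of "2 * \<epsilon> / r\<^sub>0" "1/2"] eps_pos r0 by auto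
    then have ex: "r\<^sub>0 / 2 ^ n < 2 * \<epsilon>" using r0 by (simp add: power_one_over field_simps)
    define k where "k = (LEAST n. r\<^sub>0 / 2 ^ n < 2 * \<epsilon>)"
    have "r\<^sub>0 / 2 ^ k < 2 * \<epsilon>" unfolding k_def using ex by (rule LeastI)
    moreover have "\<epsilon> \<le> r\<^sub>0 / 2 ^ k"
    proof (cases k)
      case 0
      then show ?thesis using eps by simp
    next
      case (Suc i)
      then have "\<not> r\<^sub>0 / 2 ^ i < 2 * \<epsilon>" unfolding k_def by (intro not_less_Least) simp
      then show ?thesis using Suc by simp
    qed
    ultimately show thesis using that by blast
  qed
  obtain y where y: "norm y < 1 + 2 * (L + 1) * (r\<^sub>0 - r\<^sub>0 / 2 ^ k)" "A / (r\<^sub>0 / 2 ^ k) ^ (2 * j) < u y"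
    using chain[OF k(1)] by blast
  have "2 * (L + 1) * (r\<^sub>0 - r\<^sub>0 / 2 ^ k) \<le> 2 * (L + 1) * r\<^sub>0"
    using L r0 by (intro mult_left_mono) auto
  also have "\<dots> = 2 * ((L + 1) * r\<^sub>0)" by simp
  finally have "2 * (L + 1) * (r\<^sub>0 - r\<^sub>0 / 2 ^ k) \<le> 1 / 2" using Lr0 by linarith
  then have y2: "norm y < 2" using y(1) by linarith
  have "A / (2 * \<epsilon>) ^ (2 * j) \<le> A / (r\<^sub>0 / 2 ^ k) ^ (2 * j)"
    using A k r0 eps_pos by (intro divide_left_mono power_mono) auto
  then have uy: "A / (2 * \<epsilon>) ^ (2 * j) < u y" using y(2) by linarith
  have near: "ball v \<epsilon> \<subseteq> \<Omega>" if "norm v < 3" for v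
  proof
    fix v' assume "v' \<in> ball v \<epsilon>"
    then have "norm v' < 10"
      using that norm_triangle_ineq[of v "v' - v"] eps r01 by (simp add: dist_norm norm_minus_commute)
    then show "v' \<in> \<Omega>" using dom by auto
  qed
  define m where "m = (\<alpha> / 2)\<^sup>2 * (A / (2 * \<epsilon>) ^ (2 * j))"
  have m0: "0 < m" using A alpha_pos eps_pos by (simp add: m_def)
  have "m * (2 * \<epsilon> / 8) ^ (2 * j) \<le> u 0"
  proof (rule growth_from_ball[OF dom j y2 _ _ m0])
    show "2 * \<epsilon> \<le> 1" using eps r01 by linarith
    fix v assume v: "v \<in> ball y (2 * \<epsilon>)"
    define c where "c = midpoint y v"
    have d: "dist v c < \<epsilon>" "dist c y < \<epsilon>"
      using v by (auto simp: c_def dist_midpoint dist_commute)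
    have v3: "norm v < 3" "norm c < 3"
      using norm_triangle_ineq[of y "c - y"] norm_triangle_ineq[of y "v - y"] d(2) v y2 eps r01
      by (auto simp: dist_norm norm_minus_commute)
    have "\<alpha> / 2 * u c \<le> u v" "\<alpha> / 2 * u y \<le> u c"
      using ball_le[OF near[OF v3(1)] d(1)] ball_le[OF near[OF v3(2)] d(2)] by simp_all
    then have "\<alpha> / 2 * (\<alpha> / 2 * u y) \<le> u v"
      using mult_left_mono[of "\<alpha> / 2 * u y" "u c" "\<alpha> / 2"] alpha_pos by linarith
    moreover have "m \<le> (\<alpha> / 2)\<^sup>2 * u y" unfolding m_def using uy by (intro mult_left_mono) auto
    ultimately show "m \<le> u v" by (simp add: power2_eq_square)
  qed simp
  moreover have "m * (2 * \<epsilon> / 8) ^ (2 * j) = (\<alpha> / 2)\<^sup>2 * (A / 64 ^ j)"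
    unfolding p64 m_def using eps_pos by simp
  moreover have "A / 64 ^ j = 2 + 4 / \<alpha>\<^sup>2" by (simp add: A_def)
  moreover have "(\<alpha> / 2)\<^sup>2 * (2 + 4 / \<alpha>\<^sup>2) = \<alpha>\<^sup>2 / 2 + 1"
    using alpha_pos by (simp add: power2_eq_square field_simps)
  ultimately show False using norm0 alpha_pos by simp
qed

end

section \<open>Harnack bound for p-harmonious functions\<close>

lemma tug_of_war_solution_if_positive_p_harmonious:
  fixes u :: "real ^ 'n \<Rightarrow> real"
  assumes p: "p > 2" and \<epsilon>: "0 < \<epsilon>" and "open \<Omega>" and u: "positive_p_harmonious p \<epsilon> \<Omega> u"
  shows "tug_of_war_solution (tow_alpha p CARD('n)) (tow_beta p CARD('n)) \<epsilon> \<Omega> u"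
proof
  have np: "0 < real CARD('n) + p" using p by simp
  show "0 < tow_alpha p CARD('n)" "0 < tow_beta p CARD('n)"
    using np p by (simp_all add: tow_alpha_def tow_beta_def)
  show "tow_alpha p CARD('n) + tow_beta p CARD('n) = 1"
    using np by (simp add: tow_alpha_def tow_beta_def flip: add_divide_distrib)
  have sub: "\<Omega> \<subseteq> extended_domain \<epsilon> \<Omega>" by (auto simp: extended_domain_def)
  have ph: "p_harmonious p \<epsilon> \<Omega> u" and pos: "\<forall>x\<in>extended_domain \<epsilon> \<Omega>. u x > 0"
    using u by (auto simp: positive_p_harmonious_def)
  show "u \<in> borel_measurable (restrict_space borel \<Omega>)"
    using ph measurable_restrict_mono[OF _ sub] by (auto simp: p_harmonious_def)
  show "bounded (u ` \<Omega>)"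
    using ph bounded_subset[OF _ image_mono[OF sub]] unfolding p_harmonious_def by blast
  show "0 < u x" if "x \<in> \<Omega>" for x using pos sub that by blast
  show "u x = tow_alpha p CARD('n) / 2 * ((INF y\<in>ball x \<epsilon>. u y) + (SUP y\<in>ball x \<epsilon>. u y))
      + tow_beta p CARD('n) / measure lborel (ball x \<epsilon>) * (LINT y:ball x \<epsilon>|lborel. u y)"
    if "ball x \<epsilon> \<subseteq> \<Omega>" for x
  proof -
    have "x \<in> \<Omega>" using that \<epsilon> by auto
    then show ?thesis using ph by (simp add: p_harmonious_def)
  qed
qed fact+

theorem theorem5p2:
  fixes p :: real
  assumes "p > 2"
  shows "\<exists>\<epsilon>\<^sub>0 C :: real. \<epsilon>\<^sub>0 > 0 \<and>
           (\<forall>\<epsilon> (u :: real ^ 'n \<Rightarrow> real).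
              0 < \<epsilon> \<and> \<epsilon> < \<epsilon>\<^sub>0 \<and> positive_p_harmonious p \<epsilon> (ball 0 10) u \<and> u 0 = 1
              \<longrightarrow> (SUP x\<in>ball 0 1. u x) \<le> C)"
proof -
  define \<alpha> \<beta> where "\<alpha> = tow_alpha p CARD('n)" and "\<beta> = tow_beta p CARD('n)"
  have \<alpha>: "0 < \<alpha>" using assms by (simp add: \<alpha>_def tow_alpha_def)
  \<comment> \<open>The constants are chosen one after the other, each depending only on \<open>p\<close> and the dimension: \<open>j\<close>
    for the growth estimate, \<open>K\<close> for the tug gain, and finally \<open>L\<close>, so large that the oscillation estimate
    beats the factor \<open>4 ^ j\<close>.\<close>
  obtain j :: nat where "2 * \<beta> / \<alpha> < real j" using reals_Archimedean2 by blast
  then have j: "2 * \<beta> < \<alpha> * real j" using \<alpha> by (simp add: divide_less_eq mult.commute)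
  define \<kappa> :: real where "\<kappa> = 1 / 10000"
  define K where "K = 4000 * (10 + 8 * \<beta> / \<alpha>) / \<kappa>"
  have \<kappa>: "0 < \<kappa>" "\<kappa> \<le> 1 / 10000" and K: "K * \<kappa> \<ge> 4000 * (10 + 8 * \<beta> / \<alpha>)"
    by (simp_all add: K_def \<kappa>_def)
  have "((\<lambda>L. K * (2 / L\<^sup>2) powr \<kappa> + 1 / L\<^sup>2) \<longlongrightarrow> K * 0 powr \<kappa> + 0) at_top"
  proof (intro tendsto_intros)
    have inv: "((\<lambda>L::real. c / L\<^sup>2) \<longlongrightarrow> 0) at_top" for c
      by (rule tendsto_divide_0[OF tendsto_const])
         (auto intro!: filterlim_at_top_imp_at_infinity filterlim_pow_at_top filterlim_ident)
    show "((\<lambda>L::real. 2 / L\<^sup>2) \<longlongrightarrow> 0) at_top" "((\<lambda>L::real. 1 / L\<^sup>2) \<longlongrightarrow> 0) at_top"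
      by (rule inv)+
  qed (use \<kappa> in auto)
  then have "\<forall>\<^sub>F L in at_top. K * (2 / L\<^sup>2) powr \<kappa> + 1 / L\<^sup>2 < 1 / (4 * 4 ^ j)"
    by (rule order_tendstoD) simp
  then have "\<forall>\<^sub>F L in at_top. K * (2 / L\<^sup>2) powr \<kappa> + 1 / L\<^sup>2 < 1 / (4 * 4 ^ j) \<and> 1 \<le> L"
    using eventually_ge_at_top by (rule eventually_conj)
  then obtain L where L: "1 \<le> L" "K * (2 / L\<^sup>2) powr \<kappa> + 1 / L\<^sup>2 \<le> 1 / (4 * 4 ^ j)"
    by (metis (mono_tags, lifting) eventually_happens' less_imp_le trivial_limit_at_top_linorder)
  define r\<^sub>0 where "r\<^sub>0 = 1 / (4 * (L + 1))"
  show ?thesis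
  proof (intro exI conjI allI impI; (elim conjE)?)
    show "0 < r\<^sub>0" using L by (simp add: r\<^sub>0_def)
  next
    fix \<epsilon> :: real and u :: "real ^ 'n \<Rightarrow> real"
    assume \<epsilon>: "0 < \<epsilon>" "\<epsilon> < r\<^sub>0" and u: "positive_p_harmonious p \<epsilon> (ball 0 10) u" "u 0 = 1"
    interpret tug_of_war_solution \<alpha> \<beta> \<epsilon> "ball 0 10" u
      unfolding \<alpha>_def \<beta>_def
      by (rule tug_of_war_solution_if_positive_p_harmonious) (use assms \<epsilon> u in auto)
    show "(SUP x\<in>ball 0 1. u x) \<le> (2 + 4 / \<alpha>\<^sup>2) * 64 ^ j / r\<^sub>0 ^ (2 * j)"
      using harnack_sup_bound[OF order_refl u(2) \<kappa> K j L r\<^sub>0_def] \<epsilon>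
      by (intro cSUP_least) auto
  qed
qed

end
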